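(* For each $n \geq 2$, let $z \in \{\pm 1\}^n$, let $\sigma \ge 0$ (both may depend on $n$), and let $$C = z z^\top + \sigma W \in \mathbf{R}^{n \times n},$$ where $W$ is a symmetric $n \times n$ random matrix whose off-diagonal entries are i.i.d. (up to symmetry $W_{ij}=W_{ji}$) standard normal random variables. Fix a tolerance $\epsilon > 0$ and an integer $r_0 \geq 3$, both independent of $n$, and suppose $$\sigma \leq \frac{r_0-3}{r_0-1}\sqrt{\frac{n}{(2+\epsilon)\log n}}.$$ Then, with probability $\to 1$ as $n \to \infty$, the following holds: for all integers $r \geq r_0$, every second-order critical point $Y \in \mathbf{R}^{n \times r}$ of the problem $$\max_{Y \in \mathbf{R}^{n\times r}}~\langle C, YY^\top\rangle \quad \text{s.t. } \mathrm{ddiag}(YY^\top) = I_n$$ satisfies $Y = z u^\top$ for some unit-norm $u \in \mathbf{R}^r$.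
   Context: $\langle A,B\rangle = \mathrm{trace}(A^\top B)$ is the Frobenius inner product; $\mathrm{ddiag}\colon \mathbf{R}^{n\times n}\to\mathbf{R}^{n\times n}$ keeps the diagonal of a matrix and sets the off-diagonal entries to zero. The constraint $\mathrm{ddiag}(YY^\top)=I_n$ says that every row of $Y$ is a unit vector in $\mathbf{R}^r$, so the feasible set is a Riemannian manifold (a product of $n$ unit spheres embedded in $\mathbf{R}^r$). A second-order critical point is a feasible $Y$ at which the Riemannian gradient of the objective is zero and the Riemannian Hessian is negative semidefinite. Explicitly, for symmetric $C$, put $S(Y) = \mathrm{ddiag}(CYY^\top) - C$; a feasible $Y$ is second-order critical if and only if (i) $S(Y)Y = 0$, and (ii) $\langle S(Y), \dot Y \dot Y^\top\rangle \ge 0$ for every $\dot Y\in\mathbf{R}^{n\times r}$ such that $\mathrm{ddiag}(Y\dot Y^\top)=0$. The diagonal entries of $C$ (and hence of $W$) have no effect on the set of second-order critical points. *)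

theory Defs
  imports
    "HOL-Probability.Probability"
    "Jordan_Normal_Form.Matrix"
begin

unbundle no inner_syntax and no vec_syntax

definition mat_trace :: "real mat \<Rightarrow> real" where
  "mat_trace A = (\<Sum>i<dim_row A. A $$ (i, i))"

definition frob_inner :: "real mat \<Rightarrow> real mat \<Rightarrow> real" where
  "frob_inner A B = mat_trace (transpose_mat A * B)"

definition ddiag :: "real mat \<Rightarrow> real mat" where
  "ddiag A = mat (dim_row A) (dim_col A) (\<lambda>(i, j). if i = j then A $$ (i, j) else 0)"

definition outer_prod :: "real vec \<Rightarrow> real vec \<Rightarrow> real mat" where
  "outer_prod v w = mat (dim_vec v) (dim_vec w) (\<lambda>(i, j). v $ i * w $ j)"

definition unit_mat :: "nat \<Rightarrow> nat \<Rightarrow> nat \<Rightarrow> nat \<Rightarrow> real mat" where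
  "unit_mat n r k l = mat n r (\<lambda>(i, j). if i = k \<and> j = l then 1 else 0)"


section \<open>Second-order critical points on a product of spheres\<close>

definition feasible :: "nat \<Rightarrow> nat \<Rightarrow> real mat set" where
  "feasible n r = {Y \<in> carrier_mat n r. ddiag (Y * transpose_mat Y) = 1\<^sub>m n}"

definition objective :: "real mat \<Rightarrow> real mat \<Rightarrow> real" where
  "objective C Y = frob_inner C (Y * transpose_mat Y)"

definition tangent_space :: "nat \<Rightarrow> nat \<Rightarrow> real mat \<Rightarrow> real mat set" where
  "tangent_space n r Y = {V \<in> carrier_mat n r. ddiag (Y * transpose_mat V) = 0\<^sub>m n n}"

text \<open>For feasible \<open>Y\<close> this is the orthogonal projection onto the tangent space at \<open>Y\<close>;
  see \<open>tangent_proj_in_tangent_space\<close> and \<open>tangent_proj_orthogonal\<close> below.\<close>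

definition tangent_proj :: "real mat \<Rightarrow> real mat \<Rightarrow> real mat" where
  "tangent_proj Y Z = Z - ddiag (Z * transpose_mat Y) * Y"

definition euclidean_grad :: "nat \<Rightarrow> nat \<Rightarrow> (real mat \<Rightarrow> real) \<Rightarrow> real mat \<Rightarrow> real mat" where
  "euclidean_grad n r f Y =
     mat n r (\<lambda>(i, j). deriv (\<lambda>t. f (Y + t \<cdot>\<^sub>m unit_mat n r i j)) 0)"

definition riemannian_grad :: "nat \<Rightarrow> nat \<Rightarrow> (real mat \<Rightarrow> real) \<Rightarrow> real mat \<Rightarrow> real mat" where
  "riemannian_grad n r f Y = tangent_proj Y (euclidean_grad n r f Y)"

text \<open>The Levi-Civita connection of an embedded submanifold is the tangential part of the
  ambient derivative. The formula for the Riemannian gradient makes sense off the manifold as well,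
  and this extension is the one that is differentiated.\<close>

definition riemannian_hess ::
  "nat \<Rightarrow> nat \<Rightarrow> (real mat \<Rightarrow> real) \<Rightarrow> real mat \<Rightarrow> real mat \<Rightarrow> real mat" where
  "riemannian_hess n r f Y V = tangent_proj Y
     (mat n r (\<lambda>(i, j). deriv (\<lambda>t. riemannian_grad n r f (Y + t \<cdot>\<^sub>m V) $$ (i, j)) 0))"

text \<open>The Hessian is required to be negative semidefinite: these are the second-order necessary
  conditions for a maximum.\<close>

definition second_order_critical :: "nat \<Rightarrow> nat \<Rightarrow> (real mat \<Rightarrow> real) \<Rightarrow> real mat \<Rightarrow> bool" where
  "second_order_critical n r f Y \<longleftrightarrow>
     Y \<in> feasible n r \<and>
     riemannian_grad n r f Y = 0\<^sub>m n r \<and>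
     (\<forall>V \<in> tangent_space n r Y. frob_inner V (riemannian_hess n r f Y V) \<le> 0)"

definition slack_mat :: "real mat \<Rightarrow> real mat \<Rightarrow> real mat" where
  "slack_mat C Y = ddiag (C * Y * transpose_mat Y) - C"


section \<open>Agreement with the explicit form of the conditions\<close>

lemma frob_inner_eq_sum:
  assumes "A \<in> carrier_mat n r" "B \<in> carrier_mat n r"
  shows "frob_inner A B = (\<Sum>i<n. \<Sum>j<r. A $$ (i, j) * B $$ (i, j))"
proof -
  have "frob_inner A B = (\<Sum>j<r. \<Sum>i<n. A $$ (i, j) * B $$ (i, j))"
    using assms unfolding frob_inner_def mat_trace_def
    by (auto simp: scalar_prod_def atLeast0LessThan intro!: sum.cong)
  also have "\<dots> = (\<Sum>i<n. \<Sum>j<r. A $$ (i, j) * B $$ (i, j))"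
    by (rule sum.swap)
  finally show ?thesis .
qed

lemma ddiag_carrier [simp]: "A \<in> carrier_mat n m \<Longrightarrow> ddiag A \<in> carrier_mat n m"
  by (auto simp: ddiag_def)

lemma ddiag_index:
  "A \<in> carrier_mat n m \<Longrightarrow> i < n \<Longrightarrow> j < m \<Longrightarrow> ddiag A $$ (i, j) = (if i = j then A $$ (i, j) else 0)"
  by (auto simp: ddiag_def)

lemma mult_transpose_index:
  assumes "A \<in> carrier_mat n r" "B \<in> carrier_mat m r" "i < n" "j < m"
  shows "(A * transpose_mat B) $$ (i, j) = (\<Sum>k<r. A $$ (i, k) * B $$ (j, k))"
  using assms by (auto simp: scalar_prod_def atLeast0LessThan intro!: sum.cong)

lemma mult_index:
  assumes "A \<in> carrier_mat n m" "B \<in> carrier_mat m r" "i < n" "j < r"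
  shows "((A :: real mat) * B) $$ (i, j) = (\<Sum>k<m. A $$ (i, k) * B $$ (k, j))"
  using assms by (auto simp: scalar_prod_def atLeast0LessThan intro!: sum.cong)

lemma smult_index:
  assumes "A \<in> carrier_mat n r" "i < n" "j < r"
  shows "(c \<cdot>\<^sub>m A) $$ (i, j) = (c :: real) * A $$ (i, j)"
  using assms by simp

lemma ddiag_mult_index:
  assumes "D \<in> carrier_mat n n" "Y \<in> carrier_mat n r" "i < n" "j < r"
  shows "(ddiag D * Y) $$ (i, j) = D $$ (i, i) * Y $$ (i, j)"
proof -
  have "(ddiag D * Y) $$ (i, j) = (\<Sum>k<n. ddiag D $$ (i, k) * Y $$ (k, j))"
    using assms by (intro mult_index) auto
  also have "\<dots> = (\<Sum>k<n. if k = i then D $$ (i, i) * Y $$ (i, j) else 0)"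
    using assms by (intro sum.cong) (auto simp: ddiag_index)
  finally show ?thesis using assms by simp
qed

lemma tangent_proj_carrier:
  "Y \<in> carrier_mat n r \<Longrightarrow> Z \<in> carrier_mat n r \<Longrightarrow> tangent_proj Y Z \<in> carrier_mat n r"
  unfolding tangent_proj_def by (intro minus_carrier_mat mult_carrier_mat[of _ n n]) auto

lemma tangent_proj_index:
  assumes "Y \<in> carrier_mat n r" "Z \<in> carrier_mat n r" "i < n" "j < r"
  shows "tangent_proj Y Z $$ (i, j) =
    Z $$ (i, j) - (\<Sum>k<r. Z $$ (i, k) * Y $$ (i, k)) * Y $$ (i, j)"
proof -
  have D: "Z * transpose_mat Y \<in> carrier_mat n n" using assms by auto
  have "ddiag (Z * transpose_mat Y) * Y \<in> carrier_mat n r"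
    using assms D by (intro mult_carrier_mat[of _ n n]) auto
  then have "tangent_proj Y Z $$ (i, j) = Z $$ (i, j) - (ddiag (Z * transpose_mat Y) * Y) $$ (i, j)"
    using assms unfolding tangent_proj_def by (simp del: index_mult_mat)
  then show ?thesis
    unfolding ddiag_mult_index[OF D assms(1,3,4)] mult_transpose_index[OF assms(2,1,3,3)] .
qed

lemma feasible_iff:
  "Y \<in> feasible n r \<longleftrightarrow> Y \<in> carrier_mat n r \<and> (\<forall>i<n. (\<Sum>k<r. (Y $$ (i, k))\<^sup>2) = 1)"
proof (cases "Y \<in> carrier_mat n r")
  case True
  have c: "Y * transpose_mat Y \<in> carrier_mat n n" using True by auto
  have "ddiag (Y * transpose_mat Y) = 1\<^sub>m n \<longleftrightarrow>
      (\<forall>i<n. \<forall>j<n. ddiag (Y * transpose_mat Y) $$ (i, j) = 1\<^sub>m n $$ (i, j))"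
    using ddiag_carrier[OF c] by (auto simp: mat_eq_iff)
  also have "\<dots> \<longleftrightarrow> (\<forall>i<n. (Y * transpose_mat Y) $$ (i, i) = 1)"
    using True by (auto simp: ddiag_index[OF c] simp del: index_mult_mat)
  also have "\<dots> \<longleftrightarrow> (\<forall>i<n. (\<Sum>k<r. (Y $$ (i, k))\<^sup>2) = 1)"
    using True by (simp add: mult_transpose_index power2_eq_square del: index_mult_mat)
  finally show ?thesis using True by (simp add: feasible_def)
qed (auto simp: feasible_def)

lemma tangent_space_iff:
  assumes "Y \<in> carrier_mat n r"
  shows "V \<in> tangent_space n r Y \<longleftrightarrow>
    V \<in> carrier_mat n r \<and> (\<forall>i<n. (\<Sum>k<r. Y $$ (i, k) * V $$ (i, k)) = 0)"
proof (cases "V \<in> carrier_mat n r")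
  case True
  have c: "Y * transpose_mat V \<in> carrier_mat n n" using True assms by auto
  have "ddiag (Y * transpose_mat V) = 0\<^sub>m n n \<longleftrightarrow>
      (\<forall>i<n. \<forall>j<n. ddiag (Y * transpose_mat V) $$ (i, j) = 0\<^sub>m n n $$ (i, j))"
    using ddiag_carrier[OF c] by (auto simp: mat_eq_iff)
  also have "\<dots> \<longleftrightarrow> (\<forall>i<n. (Y * transpose_mat V) $$ (i, i) = 0)"
    using True by (auto simp: ddiag_index[OF c] simp del: index_mult_mat)
  also have "\<dots> \<longleftrightarrow> (\<forall>i<n. (\<Sum>k<r. Y $$ (i, k) * V $$ (i, k)) = 0)"
    using True assms by (simp add: mult_transpose_index del: index_mult_mat)
  finally show ?thesis using True by (simp add: tangent_space_def)
qed (auto simp: tangent_space_def)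

lemma tangent_proj_in_tangent_space:
  assumes "Y \<in> feasible n r" "Z \<in> carrier_mat n r"
  shows "tangent_proj Y Z \<in> tangent_space n r Y"
proof -
  have Y: "Y \<in> carrier_mat n r" and row: "\<And>i. i < n \<Longrightarrow> (\<Sum>k<r. (Y $$ (i, k))\<^sup>2) = 1"
    using assms(1) by (auto simp: feasible_iff)
  have "(\<Sum>k<r. Y $$ (i, k) * tangent_proj Y Z $$ (i, k)) = 0" if i: "i < n" for i
  proof -
    define s where "s = (\<Sum>k<r. Z $$ (i, k) * Y $$ (i, k))"
    have "(\<Sum>k<r. Y $$ (i, k) * tangent_proj Y Z $$ (i, k)) =
        (\<Sum>k<r. Z $$ (i, k) * Y $$ (i, k) - s * (Y $$ (i, k))\<^sup>2)"
      using i
      by (intro sum.cong)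
        (simp_all add: tangent_proj_index[OF Y assms(2)] right_diff_distrib power2_eq_square flip: s_def)
    also have "\<dots> = s - s * (\<Sum>k<r. (Y $$ (i, k))\<^sup>2)"
      by (simp add: sum_subtractf sum_distrib_left s_def)
    finally show ?thesis using row[OF i] by simp
  qed
  then show ?thesis
    using tangent_proj_carrier[OF Y assms(2)] by (simp add: tangent_space_iff[OF Y])
qed

lemma frob_inner_tangent_proj:
  assumes "Y \<in> carrier_mat n r" "Z \<in> carrier_mat n r" "V \<in> tangent_space n r Y"
  shows "frob_inner V (tangent_proj Y Z) = frob_inner V Z"
proof -
  have V: "V \<in> carrier_mat n r" and orth: "\<And>i. i < n \<Longrightarrow> (\<Sum>k<r. Y $$ (i, k) * V $$ (i, k)) = 0"
    using assms(3) by (auto simp: tangent_space_iff[OF assms(1)])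
  have "frob_inner V (tangent_proj Y Z) =
      (\<Sum>i<n. \<Sum>j<r. V $$ (i, j) * tangent_proj Y Z $$ (i, j))"
    by (rule frob_inner_eq_sum[OF V tangent_proj_carrier[OF assms(1,2)]])
  also have "\<dots> = (\<Sum>i<n. \<Sum>j<r. V $$ (i, j) * Z $$ (i, j))"
  proof (rule sum.cong[OF refl])
    fix i assume "i \<in> {..<n}"
    then have i: "i < n" by simp
    define s where "s = (\<Sum>k<r. Z $$ (i, k) * Y $$ (i, k))"
    have "(\<Sum>j<r. V $$ (i, j) * tangent_proj Y Z $$ (i, j)) =
        (\<Sum>j<r. V $$ (i, j) * Z $$ (i, j) - s * (Y $$ (i, j) * V $$ (i, j)))"
      using i
      by (intro sum.cong)
        (simp_all add: tangent_proj_index[OF assms(1,2)] right_diff_distrib flip: s_def)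
    also have "\<dots> = (\<Sum>j<r. V $$ (i, j) * Z $$ (i, j)) - s * (\<Sum>j<r. Y $$ (i, j) * V $$ (i, j))"
      by (simp add: sum_subtractf sum_distrib_left)
    finally show "(\<Sum>j<r. V $$ (i, j) * tangent_proj Y Z $$ (i, j)) =
        (\<Sum>j<r. V $$ (i, j) * Z $$ (i, j))"
      using orth[OF i] by simp
  qed
  also have "\<dots> = frob_inner V Z"
    by (rule frob_inner_eq_sum[OF V assms(2), symmetric])
  finally show ?thesis .
qed

lemma tangent_proj_orthogonal:
  assumes "Y \<in> carrier_mat n r" "Z \<in> carrier_mat n r" "V \<in> tangent_space n r Y"
  shows "frob_inner V (Z - tangent_proj Y Z) = 0"
proof -
  have V: "V \<in> carrier_mat n r"
    using assms(3) by (simp add: tangent_space_def)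
  note P = tangent_proj_carrier[OF assms(1,2)]
  have "frob_inner V (Z - tangent_proj Y Z) = frob_inner V Z - frob_inner V (tangent_proj Y Z)"
    using assms(2) P V minus_carrier_mat[OF P, of Z]
    by (simp add: frob_inner_eq_sum[of _ n r] algebra_simps sum_subtractf)
  then show ?thesis
    using frob_inner_tangent_proj[OF assms] by simp
qed

lemma objective_eq_sum:
  assumes "C \<in> carrier_mat n n" "Y \<in> carrier_mat n r"
  shows "objective C Y = (\<Sum>a<n. \<Sum>b<n. C $$ (a, b) * (\<Sum>k<r. Y $$ (a, k) * Y $$ (b, k)))"
proof -
  have c: "Y * transpose_mat Y \<in> carrier_mat n n" using assms by auto
  show ?thesis
    unfolding objective_def frob_inner_eq_sum[OF assms(1) c]
    using assms by (intro sum.cong refl) (simp add: mult_transpose_index del: index_mult_mat)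
qed

lemma DERIV_affine_prod:
  fixes a b c d :: real
  shows "((\<lambda>t. (a + t * b) * (c + t * d)) has_real_derivative b * c + a * d) (at 0)"
  by (auto intro!: derivative_eq_intros)

lemma euclidean_grad_objective:
  assumes C: "C \<in> carrier_mat n n" and sym: "transpose_mat C = C" and Y: "Y \<in> carrier_mat n r"
  shows "euclidean_grad n r (objective C) Y = 2 \<cdot>\<^sub>m (C * Y)"
proof (rule eq_matI)
  fix i j assume "i < dim_row (2 \<cdot>\<^sub>m (C * Y))" "j < dim_col (2 \<cdot>\<^sub>m (C * Y))"
  then have i: "i < n" and j: "j < r" using C Y by auto
  define E where "E = unit_mat n r i j"
  have E: "E \<in> carrier_mat n r" by (simp add: E_def unit_mat_def)
  have Eix: "E $$ (a, k) = (if a = i \<and> k = j then 1 else 0)" if "a < n" "k < r" for a k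
    using that by (simp add: E_def unit_mat_def)
  have Csym: "C $$ (a, b) = C $$ (b, a)" if "a < n" "b < n" for a b
    using that C sym by (metis carrier_matD index_transpose_mat(1))
  have eq: "objective C (Y + t \<cdot>\<^sub>m E) =
      (\<Sum>a<n. \<Sum>b<n. C $$ (a, b) *
        (\<Sum>k<r. (Y $$ (a, k) + t * E $$ (a, k)) * (Y $$ (b, k) + t * E $$ (b, k))))" for t
    using Y E by (subst objective_eq_sum[OF C, of _ r]) (auto intro!: sum.cong)
  have "((\<lambda>t. objective C (Y + t \<cdot>\<^sub>m E)) has_real_derivative
      (\<Sum>a<n. \<Sum>b<n. C $$ (a, b) *
        (\<Sum>k<r. E $$ (a, k) * Y $$ (b, k) + Y $$ (a, k) * E $$ (b, k)))) (at 0)"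
    unfolding eq by (intro DERIV_sum DERIV_cmult DERIV_affine_prod)
  then have "deriv (\<lambda>t. objective C (Y + t \<cdot>\<^sub>m E)) 0 =
      (\<Sum>a<n. \<Sum>b<n. C $$ (a, b) *
        (\<Sum>k<r. E $$ (a, k) * Y $$ (b, k) + Y $$ (a, k) * E $$ (b, k)))"
    by (rule DERIV_imp_deriv)
  also have "\<dots> = (\<Sum>a<n. \<Sum>b<n. (if a = i then C $$ (i, b) * Y $$ (b, j) else 0) +
      (if b = i then C $$ (a, i) * Y $$ (a, j) else 0))"
  proof (intro sum.cong refl)
    fix a b assume "a \<in> {..<n}" "b \<in> {..<n}"
    then have ab: "a < n" "b < n" by auto
    have "(\<Sum>k<r. E $$ (a, k) * Y $$ (b, k) + Y $$ (a, k) * E $$ (b, k)) =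
        (\<Sum>k<r. (if k = j then (if a = i then Y $$ (b, j) else 0) +
          (if b = i then Y $$ (a, j) else 0) else 0))"
      using ab by (intro sum.cong refl) (auto simp: Eix)
    also have "\<dots> = (if a = i then Y $$ (b, j) else 0) + (if b = i then Y $$ (a, j) else 0)"
      using j by simp
    finally show "C $$ (a, b) * (\<Sum>k<r. E $$ (a, k) * Y $$ (b, k) + Y $$ (a, k) * E $$ (b, k)) =
        (if a = i then C $$ (i, b) * Y $$ (b, j) else 0) +
        (if b = i then C $$ (a, i) * Y $$ (a, j) else 0)"
      by (auto simp: algebra_simps)
  qed
  also have "\<dots> = (\<Sum>a<n. if a = i then (\<Sum>b<n. C $$ (i, b) * Y $$ (b, j)) else 0) +
      (\<Sum>a<n. C $$ (a, i) * Y $$ (a, j))"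
  proof -
    have "(\<Sum>b<n. (if a = i then C $$ (i, b) * Y $$ (b, j) else 0) +
      (if b = i then C $$ (a, i) * Y $$ (a, j) else 0)) =
      (if a = i then (\<Sum>b<n. C $$ (i, b) * Y $$ (b, j)) else 0) + C $$ (a, i) * Y $$ (a, j)" for a
      using i by (simp add: sum.distrib)
    then show ?thesis by (simp add: sum.distrib)
  qed
  also have "\<dots> = 2 * (\<Sum>b<n. C $$ (i, b) * Y $$ (b, j))"
    using i Csym by simp
  also have "\<dots> = (2 \<cdot>\<^sub>m (C * Y)) $$ (i, j)"
    using C Y i j mult_index[OF C Y i j] by simp
  finally show "euclidean_grad n r (objective C) Y $$ (i, j) = (2 \<cdot>\<^sub>m (C * Y)) $$ (i, j)"
    using i j by (simp add: euclidean_grad_def E_def)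
qed (use C Y in \<open>auto simp: euclidean_grad_def\<close>)

lemma slack_mat_carrier:
  "C \<in> carrier_mat n n \<Longrightarrow> Y \<in> carrier_mat n r \<Longrightarrow> slack_mat C Y \<in> carrier_mat n n"
  unfolding slack_mat_def by (auto intro!: minus_carrier_mat)

lemma slack_mat_mult_index:
  assumes C: "C \<in> carrier_mat n n" and Y: "Y \<in> carrier_mat n r" and V: "V \<in> carrier_mat n m"
    and i: "i < n" and j: "j < m"
  shows "(slack_mat C Y * V) $$ (i, j) =
    (\<Sum>k<r. (C * Y) $$ (i, k) * Y $$ (i, k)) * V $$ (i, j) - (C * V) $$ (i, j)"
proof -
  have CY: "C * Y \<in> carrier_mat n r" using C Y by auto
  have D: "C * Y * transpose_mat Y \<in> carrier_mat n n" using CY Y by auto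
  have "slack_mat C Y * V = ddiag (C * Y * transpose_mat Y) * V - C * V"
    unfolding slack_mat_def by (rule minus_mult_distrib_mat[OF ddiag_carrier[OF D] C V])
  then have "(slack_mat C Y * V) $$ (i, j) =
      (ddiag (C * Y * transpose_mat Y) * V) $$ (i, j) - (C * V) $$ (i, j)"
    using C V i j by simp
  then show ?thesis
    using ddiag_mult_index[OF D V i j] mult_transpose_index[OF CY Y i i]
    by (simp del: index_mult_mat)
qed

lemma riemannian_grad_objective:
  assumes C: "C \<in> carrier_mat n n" and sym: "transpose_mat C = C" and Y: "Y \<in> carrier_mat n r"
  shows "riemannian_grad n r (objective C) Y = (-2) \<cdot>\<^sub>m (slack_mat C Y * Y)"
proof -
  have CY: "C * Y \<in> carrier_mat n r" using C Y by auto
  then have CY2: "2 \<cdot>\<^sub>m (C * Y) \<in> carrier_mat n r" by simp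
  have SY: "slack_mat C Y * Y \<in> carrier_mat n r"
    using slack_mat_carrier[OF C Y] Y by auto
  show ?thesis
    unfolding riemannian_grad_def euclidean_grad_objective[OF C sym Y]
  proof (rule eq_matI)
    fix i j assume "i < dim_row ((-2) \<cdot>\<^sub>m (slack_mat C Y * Y))"
      "j < dim_col ((-2) \<cdot>\<^sub>m (slack_mat C Y * Y))"
    then have i: "i < n" and j: "j < r" using SY by auto
    have "tangent_proj Y (2 \<cdot>\<^sub>m (C * Y)) $$ (i, j) = 2 * (C * Y) $$ (i, j) -
        (\<Sum>k<r. 2 * (C * Y) $$ (i, k) * Y $$ (i, k)) * Y $$ (i, j)"
      unfolding tangent_proj_index[OF Y CY2 i j]
      using i j by (simp add: smult_index[OF CY] del: index_mult_mat index_smult_mat)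
    also have "\<dots> = - 2 * (slack_mat C Y * Y) $$ (i, j)"
      unfolding slack_mat_mult_index[OF C Y Y i j]
      by (simp add: mult.assoc right_diff_distrib del: index_mult_mat flip: sum_distrib_left)
    finally show "tangent_proj Y (2 \<cdot>\<^sub>m (C * Y)) $$ (i, j) =
        ((-2) \<cdot>\<^sub>m (slack_mat C Y * Y)) $$ (i, j)"
      using smult_index[OF SY i j, of "-2"] by simp
  qed (use SY tangent_proj_carrier[OF Y CY2] in auto)
qed

lemma riemannian_hess_objective:
  assumes C: "C \<in> carrier_mat n n" and sym: "transpose_mat C = C"
    and Y: "Y \<in> carrier_mat n r" and V: "V \<in> tangent_space n r Y"
  shows "frob_inner V (riemannian_hess n r (objective C) Y V) =
    - 2 * frob_inner (slack_mat C Y) (V * transpose_mat V)"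
proof -
  have Vc: "V \<in> carrier_mat n r" using V by (simp add: tangent_space_def)
  have orth: "\<And>i. i < n \<Longrightarrow> (\<Sum>k<r. Y $$ (i, k) * V $$ (i, k)) = 0"
    using V by (simp add: tangent_space_iff[OF Y])
  have CY: "C * Y \<in> carrier_mat n r" and CV: "C * V \<in> carrier_mat n r" using C Y Vc by auto
  have S: "slack_mat C Y \<in> carrier_mat n n" by (rule slack_mat_carrier[OF C Y])
  have SV: "slack_mat C Y * V \<in> carrier_mat n r" using S Vc by auto
  define D where "D = mat n r
    (\<lambda>(i, j). deriv (\<lambda>t. riemannian_grad n r (objective C) (Y + t \<cdot>\<^sub>m V) $$ (i, j)) 0)"
  have Dc: "D \<in> carrier_mat n r" by (simp add: D_def)
  define d where "d i = (\<Sum>k<r. (C * V) $$ (i, k) * Y $$ (i, k) + (C * Y) $$ (i, k) * V $$ (i, k))" for i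
  have D: "D $$ (i, j) = - 2 * (slack_mat C Y * V) $$ (i, j) - 2 * d i * Y $$ (i, j)"
    if i: "i < n" and j: "j < r" for i j
  proof -
    have eq: "riemannian_grad n r (objective C) (Y + t \<cdot>\<^sub>m V) $$ (i, j) =
       - 2 * ((\<Sum>k<r. ((C * Y) $$ (i, k) + t * (C * V) $$ (i, k)) * (Y $$ (i, k) + t * V $$ (i, k))) *
        (Y $$ (i, j) + t * V $$ (i, j)) - ((C * Y) $$ (i, j) + t * (C * V) $$ (i, j)))" for t
    proof -
      let ?Y = "Y + t \<cdot>\<^sub>m V"
      have Yt: "?Y \<in> carrier_mat n r" using Y Vc by auto
      have SYt: "slack_mat C ?Y * ?Y \<in> carrier_mat n r"
        using slack_mat_carrier[OF C Yt] Yt by auto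
      have CYt: "(C * ?Y) $$ (i, k) = (C * Y) $$ (i, k) + t * (C * V) $$ (i, k)" if k: "k < r" for k
      proof -
        have "C * ?Y = C * Y + t \<cdot>\<^sub>m (C * V)"
          using C Y Vc by (simp add: mult_add_distrib_mat[OF C Y, of "t \<cdot>\<^sub>m V"] mult_smult_distrib[OF C Vc])
        then show ?thesis
          using C Y Vc i k by (simp del: index_mult_mat(1))
      qed
      have "riemannian_grad n r (objective C) ?Y $$ (i, j) = - 2 * (slack_mat C ?Y * ?Y) $$ (i, j)"
        unfolding riemannian_grad_objective[OF C sym Yt]
        using smult_index[OF SYt i j] .
      also have "\<dots> = - 2 * ((\<Sum>k<r. (C * ?Y) $$ (i, k) * ?Y $$ (i, k)) * ?Y $$ (i, j) - (C * ?Y) $$ (i, j))"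
        unfolding slack_mat_mult_index[OF C Yt Yt i j] ..
      also have "(\<Sum>k<r. (C * ?Y) $$ (i, k) * ?Y $$ (i, k)) =
          (\<Sum>k<r. ((C * Y) $$ (i, k) + t * (C * V) $$ (i, k)) * (Y $$ (i, k) + t * V $$ (i, k)))"
        using Y Vc i by (intro sum.cong) (auto simp: CYt simp del: index_mult_mat(1))
      also have "?Y $$ (i, j) = Y $$ (i, j) + t * V $$ (i, j)"
        using Y Vc i j by simp
      finally show ?thesis
        by (simp only: CYt[OF j])
    qed
    have "((\<lambda>t. riemannian_grad n r (objective C) (Y + t \<cdot>\<^sub>m V) $$ (i, j)) has_real_derivative
        - 2 * (d i * Y $$ (i, j) + (\<Sum>k<r. (C * Y) $$ (i, k) * Y $$ (i, k)) * V $$ (i, j) -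
          (C * V) $$ (i, j))) (at 0)"
    proof -
      define g where "g t = (\<Sum>k<r. ((C * Y) $$ (i, k) + t * (C * V) $$ (i, k)) *
        (Y $$ (i, k) + t * V $$ (i, k)))" for t
      have g': "(g has_real_derivative d i) (at 0)"
        unfolding g_def d_def by (intro DERIV_sum DERIV_affine_prod)
      have g0: "g 0 = (\<Sum>k<r. (C * Y) $$ (i, k) * Y $$ (i, k))"
        by (simp add: g_def del: index_mult_mat)
      have aff: "((\<lambda>t. a + t * b) has_real_derivative b) (at 0)" for a b :: real
        by (auto intro!: derivative_eq_intros)
      show ?thesis
        unfolding eq g_def[symmetric] g0[symmetric]
        by (rule DERIV_cong[OF DERIV_cmult[OF DERIV_diff[OF DERIV_mult[OF g' aff] aff]]])
          (simp add: algebra_simps)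
    qed
    then have "D $$ (i, j) =
        - 2 * (d i * Y $$ (i, j) + (\<Sum>k<r. (C * Y) $$ (i, k) * Y $$ (i, k)) * V $$ (i, j) -
          (C * V) $$ (i, j))"
      using i j by (simp add: D_def DERIV_imp_deriv del: index_mult_mat)
    also have "\<dots> = - 2 * (slack_mat C Y * V) $$ (i, j) - 2 * d i * Y $$ (i, j)"
      unfolding slack_mat_mult_index[OF C Y Vc i j] by (simp add: algebra_simps del: index_mult_mat)
    finally show ?thesis .
  qed
  have "frob_inner V (riemannian_hess n r (objective C) Y V) = frob_inner V D"
    unfolding riemannian_hess_def D_def[symmetric] by (rule frob_inner_tangent_proj[OF Y Dc V])
  also have "\<dots> = (\<Sum>i<n. \<Sum>j<r. V $$ (i, j) * D $$ (i, j))"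
    by (rule frob_inner_eq_sum[OF Vc Dc])
  also have "\<dots> = (\<Sum>i<n. - 2 * (\<Sum>j<r. V $$ (i, j) * (slack_mat C Y * V) $$ (i, j)) -
      2 * d i * (\<Sum>j<r. Y $$ (i, j) * V $$ (i, j)))"
    by (intro sum.cong refl)
      (simp add: D sum_subtractf sum_distrib_left sum_negf algebra_simps del: index_mult_mat)
  also have "\<dots> = - 2 * (\<Sum>i<n. \<Sum>j<r. V $$ (i, j) * (slack_mat C Y * V) $$ (i, j))"
    using orth by (simp add: sum_distrib_left sum_negf del: index_mult_mat)
  also have "(\<Sum>i<n. \<Sum>j<r. V $$ (i, j) * (slack_mat C Y * V) $$ (i, j)) =
      (\<Sum>i<n. \<Sum>j<r. \<Sum>k<n. slack_mat C Y $$ (i, k) * (V $$ (i, j) * V $$ (k, j)))"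
    by (intro sum.cong refl)
      (simp add: mult_index[OF S Vc] sum_distrib_left algebra_simps del: index_mult_mat)
  also have "\<dots> = (\<Sum>i<n. \<Sum>k<n. slack_mat C Y $$ (i, k) * (V * transpose_mat V) $$ (i, k))"
  proof (rule sum.cong[OF refl])
    fix i assume "i \<in> {..<n}"
    then have i: "i < n" by simp
    have "(\<Sum>j<r. \<Sum>k<n. slack_mat C Y $$ (i, k) * (V $$ (i, j) * V $$ (k, j))) =
        (\<Sum>k<n. \<Sum>j<r. slack_mat C Y $$ (i, k) * (V $$ (i, j) * V $$ (k, j)))"
      by (rule sum.swap)
    also have "\<dots> = (\<Sum>k<n. slack_mat C Y $$ (i, k) * (V * transpose_mat V) $$ (i, k))"
      using i by (intro sum.cong refl)
        (simp add: mult_transpose_index[OF Vc Vc] sum_distrib_left del: index_mult_mat)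
    finally show "(\<Sum>j<r. \<Sum>k<n. slack_mat C Y $$ (i, k) * (V $$ (i, j) * V $$ (k, j))) =
        (\<Sum>k<n. slack_mat C Y $$ (i, k) * (V * transpose_mat V) $$ (i, k))" .
  qed
  also have "\<dots> = frob_inner (slack_mat C Y) (V * transpose_mat V)"
    using Vc by (intro frob_inner_eq_sum[OF S, symmetric]) auto
  finally show ?thesis .
qed

theorem second_order_critical_objective_iff:
  assumes C: "C \<in> carrier_mat n n" and sym: "transpose_mat C = C"
  shows "second_order_critical n r (objective C) Y \<longleftrightarrow>
    Y \<in> feasible n r \<and>
    slack_mat C Y * Y = 0\<^sub>m n r \<and>
    (\<forall>V \<in> tangent_space n r Y. frob_inner (slack_mat C Y) (V * transpose_mat V) \<ge> 0)"
proof (cases "Y \<in> feasible n r")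
  case True
  then have Y: "Y \<in> carrier_mat n r" by (simp add: feasible_def)
  have SY: "slack_mat C Y * Y \<in> carrier_mat n r"
    using slack_mat_carrier[OF C Y] Y by auto
  have "riemannian_grad n r (objective C) Y = 0\<^sub>m n r \<longleftrightarrow> slack_mat C Y * Y = 0\<^sub>m n r"
    unfolding riemannian_grad_objective[OF C sym Y]
    using SY by (auto simp: mat_eq_iff smult_index[OF SY] simp del: index_mult_mat index_smult_mat(1))
  moreover have "(\<forall>V \<in> tangent_space n r Y.
        frob_inner V (riemannian_hess n r (objective C) Y V) \<le> 0) \<longleftrightarrow>
      (\<forall>V \<in> tangent_space n r Y. frob_inner (slack_mat C Y) (V * transpose_mat V) \<ge> 0)"
    by (intro ball_cong refl) (simp add: riemannian_hess_objective[OF C sym Y])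
  ultimately show ?thesis
    by (simp add: second_order_critical_def)
qed (simp add: second_order_critical_def)

end

theory Submission
  imports Defs
begin

text \<open>After conjugation by the signs \<open>z\<close> the signal becomes the all-ones matrix and the claim is that all
rows \<open>x\<^sub>i = z\<^sub>i y\<^sub>i\<close> of a second-order critical point coincide. Test the Hessian in the directions that push
every row towards a common vector (projected to the sphere), and average over that vector: with
\<open>G\<^sub>i\<^sub>j = \<langle>x\<^sub>i, x\<^sub>j\<rangle>\<close> and \<open>H = 1 - G \<ge> 0\<close> this gives
\<open>\<Sum> (1 + A\<^sub>i\<^sub>j) ((r - 3) H\<^sub>i\<^sub>j + H\<^sub>i\<^sub>j\<^sup>2) \<le> 0\<close> (\<open>second_order_inequality\<close>), where \<open>A\<close> is the conjugated noise. Without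
noise this forces \<open>H = 0\<close>.

The noise terms \<open>\<langle>A, H\<rangle>\<close> and \<open>\<langle>A, 1 - G\<^sup>2\<rangle>\<close> are quadratic forms of the Laplacian of \<open>A\<close>, evaluated at the
points \<open>x\<^sub>i\<close> and \<open>x\<^sub>i \<otimes> x\<^sub>i\<close>. Such a form sees the row sums of \<open>A\<close> and its operator norm.
If all row sums are at most \<open>D\<close> in absolute value and the operator norm is at most \<open>N\<close>, then
\<open>(r - 1) D + (r + 3) N \<le> (r - 3) n\<close> suffices for \<open>H = 0\<close> (\<open>rows_agree\<close>).

For Gaussian noise the row sums are at most about \<open>\<sigma> \<surd>(2 n ln n)\<close>, by a union bound over \<open>n\<close> Gaussian tails,
while the operator norm is only of order \<open>\<sigma> \<surd>n\<close> (\<open>gaussian_matrix_bounds\<close>). The second is therefore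
negligible and the first produces the threshold \<open>(r - 3) / (r - 1)\<close> times \<open>\<surd>(n / (2 ln n))\<close>. For the operator norm
a union bound over the integer points of a ball of radius \<open>8 \<surd>n\<close> is used, since rounding to the lattice is
an explicit net.

The probability in the theorem is that of an event defined by quantifying over all critical points, and its
measurability needs an argument of its own (\<open>sets_critical_not_aligned\<close>): the exceptional set is a
countable union of projections, along a compact set, of closed sets.\<close>

section \<open>Laplacian forms on the sphere\<close>

lemma sum_rotate:
  "(\<Sum>k\<in>K. \<Sum>i\<in>I. \<Sum>j\<in>J. h k i j) = (\<Sum>i\<in>I. \<Sum>j\<in>J. \<Sum>k\<in>K. h k i j)"
  by (subst sum.swap, intro sum.cong refl, rule sum.swap)

lemma sum_sq_centred_pairs:
  fixes f :: "nat \<Rightarrow> real"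
  shows "(\<Sum>i<n. \<Sum>j<n. (f i - f j)\<^sup>2) = 2 * real n * (\<Sum>i<n. (f i - (\<Sum>j<n. f j) / n)\<^sup>2)"
proof (cases "n = 0")
  case False
  define s where "s = (\<Sum>j<n. f j)"
  have "(\<Sum>i<n. \<Sum>j<n. (f i - f j)\<^sup>2) = 2 * real n * (\<Sum>i<n. (f i)\<^sup>2) - 2 * s\<^sup>2"
    unfolding s_def power2_diff power2_eq_square[of "sum f _"] sum_product
    by (simp add: sum.distrib sum_subtractf mult.assoc flip: sum_distrib_left)
  also have "\<dots> = 2 * real n * (\<Sum>i<n. (f i - s / n)\<^sup>2)"
    using False
    by (simp add: power2_diff sum.distrib sum_subtractf s_def power2_eq_square field_simps
        flip: sum_distrib_left sum_distrib_right sum_divide_distrib)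
  finally show ?thesis by (simp add: s_def)
qed simp

text \<open>The left-hand side is the quadratic form of the Laplacian of \<open>A\<close>, which annihilates constants.
Hence \<open>f\<close> may be shifted by any \<open>c\<close>, and the form splits into a diagonal part, governed by the row sums
of \<open>A\<close>, and the quadratic form of \<open>A\<close> itself. For Gaussian noise the diagonal part dominates.\<close>

lemma laplacian_form:
  fixes A :: "nat \<Rightarrow> nat \<Rightarrow> real" and f :: "nat \<Rightarrow> real"
  assumes sym: "\<And>i j. i < n \<Longrightarrow> j < n \<Longrightarrow> A i j = A j i"
  shows "(\<Sum>i<n. \<Sum>j<n. A i j * (f i - f j)\<^sup>2) =
    2 * (\<Sum>i<n. (\<Sum>j<n. A i j) * (f i - c)\<^sup>2) -
    2 * (\<Sum>i<n. \<Sum>j<n. A i j * (f i - c) * (f j - c))"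
proof -
  define g where "g i = f i - c" for i
  have "(\<Sum>i<n. \<Sum>j<n. A i j * (f i - f j)\<^sup>2) =
    (\<Sum>i<n. \<Sum>j<n. A i j * (g i)\<^sup>2 + A i j * (g j)\<^sup>2 - 2 * (A i j * g i * g j))"
    by (intro sum.cong refl) (simp add: g_def power2_eq_square algebra_simps)
  also have "\<dots> = (\<Sum>i<n. \<Sum>j<n. A i j * (g i)\<^sup>2) + (\<Sum>i<n. \<Sum>j<n. A i j * (g j)\<^sup>2)
      - 2 * (\<Sum>i<n. \<Sum>j<n. A i j * g i * g j)"
    by (simp add: sum.distrib sum_subtractf sum_distrib_left)
  also have "(\<Sum>i<n. \<Sum>j<n. A i j * (g j)\<^sup>2) = (\<Sum>i<n. \<Sum>j<n. A i j * (g i)\<^sup>2)"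
    by (subst sum.swap) (intro sum.cong refl, use sym in auto)
  finally show ?thesis by (simp add: g_def sum_distrib_right)
qed

lemma laplacian_form_family:
  fixes A :: "nat \<Rightarrow> nat \<Rightarrow> real" and f :: "nat \<Rightarrow> 'k \<Rightarrow> real"
  assumes sym: "\<And>i j. i < n \<Longrightarrow> j < n \<Longrightarrow> A i j = A j i"
  shows "(\<Sum>i<n. \<Sum>j<n. A i j * (\<Sum>k\<in>K. (f i k - f j k)\<^sup>2)) =
    2 * (\<Sum>i<n. (\<Sum>j<n. A i j) * (\<Sum>k\<in>K. (f i k - c k)\<^sup>2)) -
    2 * (\<Sum>k\<in>K. \<Sum>i<n. \<Sum>j<n. A i j * (f i k - c k) * (f j k - c k))"
proof -
  have "(\<Sum>i<n. \<Sum>j<n. A i j * (\<Sum>k\<in>K. (f i k - f j k)\<^sup>2)) =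
     (\<Sum>k\<in>K. \<Sum>i<n. \<Sum>j<n. A i j * (f i k - f j k)\<^sup>2)"
    by (subst sum_rotate) (simp add: sum_distrib_left)
  also have "\<dots> = (\<Sum>k\<in>K. 2 * (\<Sum>i<n. (\<Sum>j<n. A i j) * (f i k - c k)\<^sup>2) -
    2 * (\<Sum>i<n. \<Sum>j<n. A i j * (f i k - c k) * (f j k - c k)))"
    by (intro sum.cong refl laplacian_form sym)
  also have "\<dots> = 2 * (\<Sum>i<n. (\<Sum>j<n. A i j) * (\<Sum>k\<in>K. (f i k - c k)\<^sup>2)) -
    2 * (\<Sum>k\<in>K. \<Sum>i<n. \<Sum>j<n. A i j * (f i k - c k) * (f j k - c k))"
    by (simp add: sum_subtractf sum_distrib_left sum.swap[of _ K])
  finally show ?thesis .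
qed

lemma quadratic_form_family_bound:
  fixes A :: "nat \<Rightarrow> nat \<Rightarrow> real" and f :: "nat \<Rightarrow> 'k \<Rightarrow> real"
  assumes "\<And>v. \<bar>\<Sum>i<n. \<Sum>j<n. A i j * v i * v j\<bar> \<le> N * (\<Sum>i<n. (v i)\<^sup>2)"
  shows "\<bar>\<Sum>k\<in>K. \<Sum>i<n. \<Sum>j<n. A i j * f i k * f j k\<bar> \<le> N * (\<Sum>i<n. \<Sum>k\<in>K. (f i k)\<^sup>2)"
proof -
  have "\<bar>\<Sum>k\<in>K. \<Sum>i<n. \<Sum>j<n. A i j * f i k * f j k\<bar> \<le> (\<Sum>k\<in>K. N * (\<Sum>i<n. (f i k)\<^sup>2))"
    by (rule order.trans[OF sum_abs]) (intro sum_mono assms[of "\<lambda>i. f i _"])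
  also have "\<dots> = N * (\<Sum>i<n. \<Sum>k\<in>K. (f i k)\<^sup>2)"
    by (simp add: sum.swap[of _ K] flip: sum_distrib_left)
  finally show ?thesis .
qed

definition rowdot :: "nat \<Rightarrow> (nat \<Rightarrow> real) \<Rightarrow> (nat \<Rightarrow> real) \<Rightarrow> real" where
  "rowdot r x y = (\<Sum>k<r. x k * y k)"

lemma sum_sq_diff: "(\<Sum>k<r. (x k - y k)\<^sup>2) = rowdot r x x - 2 * rowdot r x y + rowdot r y y"
  by (simp add: rowdot_def power2_diff sum.distrib sum_subtractf power2_eq_square
      sum_distrib_left algebra_simps)

lemma rowdot_Cauchy_Schwarz: "(rowdot r x y)\<^sup>2 \<le> rowdot r x x * rowdot r y y"
  unfolding rowdot_def using Cauchy_Schwarz_ineq_sum[of x y "{..<r}"]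
  by (simp add: power2_eq_square)

text \<open>The points \<open>x \<otimes> x\<close> have inner products \<open>\<langle>x, y\<rangle>\<^sup>2\<close>, so the squared entries of a Gram matrix
can be handled by the same Laplacian identity as the entries themselves.\<close>

lemma sum_sq_diff_tensor:
  "(\<Sum>(k, l)\<in>{..<r} \<times> {..<r}. (x k * x l - y k * y l)\<^sup>2) =
    (rowdot r x x)\<^sup>2 - 2 * (rowdot r x y)\<^sup>2 + (rowdot r y y)\<^sup>2"
proof -
  have "(\<Sum>(k, l)\<in>{..<r} \<times> {..<r}. (x k * x l - y k * y l)\<^sup>2) =
    (\<Sum>k<r. \<Sum>l<r. (x k * x k) * (x l * x l) - 2 * ((x k * y k) * (x l * y l)) + (y k * y k) * (y l * y l))"
    unfolding sum.cartesian_product[symmetric]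
    by (intro sum.cong refl) (simp add: power2_eq_square algebra_simps)
  also have "\<dots> = (rowdot r x x)\<^sup>2 - 2 * (rowdot r x y)\<^sup>2 + (rowdot r y y)\<^sup>2"
    unfolding rowdot_def power2_eq_square sum_product
    by (simp add: sum.distrib sum_subtractf flip: sum_distrib_left)
  finally show ?thesis .
qed

text \<open>With \<open>p = \<langle>x, c\<rangle>\<close> and \<open>q = |c|\<^sup>2\<close> for a unit vector \<open>x\<close>, this is
\<open>|x \<otimes> x - c \<otimes> c|\<^sup>2 \<le> 4 |x - c|\<^sup>2\<close>. The difference of the two sides increases in \<open>q\<close>, and at the least
admissible value \<open>q = p\<^sup>2\<close> it equals \<open>(1 - p)\<^sup>3 (3 + p)\<close>.\<close>

lemma tensor_distance_le:
  fixes p q :: real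
  assumes "p\<^sup>2 \<le> q" "q \<le> 1"
  shows "1 - 2 * p\<^sup>2 + q\<^sup>2 \<le> 4 * (1 - 2 * p + q)"
proof -
  have p: "\<bar>p\<bar> \<le> 1" using assms by (meson abs_square_le_1 order.trans)
  have "0 \<le> (q - p\<^sup>2) * (4 - q - p\<^sup>2)"
    using assms by (intro mult_nonneg_nonneg) auto
  moreover have "0 \<le> (1 - p) ^ 3 * (3 + p)" using p by (intro mult_nonneg_nonneg) auto
  ultimately show ?thesis by (simp add: algebra_simps power2_eq_square power3_eq_cube)
qed

text \<open>Write \<open>G\<close> for the Gram matrix of the rows, \<open>H = 1 - G\<close>, and let \<open>c\<close> be the mean of the rows.
The noise contributes \<open>- \<langle>A, (r - 3) H + H\<^sup>2\<rangle> = - (r - 1) \<langle>A, H\<rangle> + \<langle>A, 1 - G\<^sup>2\<rangle>\<close>. Both terms are Laplacian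
forms, of the points \<open>x\<^sub>i\<close> centred at \<open>c\<close> and of the points \<open>x\<^sub>i \<otimes> x\<^sub>i\<close> centred at \<open>c \<otimes> c\<close>. With
\<open>a\<^sub>i = |x\<^sub>i - c|\<^sup>2\<close> and \<open>b\<^sub>i = |x\<^sub>i \<otimes> x\<^sub>i - c \<otimes> c|\<^sup>2\<close>, their diagonal parts combine to
\<open>- \<Sum> d\<^sub>i ((r - 1) a\<^sub>i - b\<^sub>i)\<close>, and \<open>0 \<le> b\<^sub>i \<le> 4 a\<^sub>i \<le> 2 (r - 1) a\<^sub>i\<close> makes the bracket at most
\<open>(r - 1) a\<^sub>i\<close> in absolute value. Estimating the two terms separately would lose this cancellation and give
\<open>r + 1\<close> in place of the factor \<open>r - 1\<close>.

Since \<open>\<Sum> H = n \<Sum> a\<^sub>i\<close>, the total noise is at most \<open>(r - 3) \<Sum> H\<close>, which leaves \<open>\<Sum> H\<^sup>2 \<le> 0\<close>. The quadratic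
term is what allows equality in the smallness hypothesis, and with it the case \<open>r = 3\<close>, \<open>A = 0\<close>.\<close>

lemma rows_agree:
  fixes A :: "nat \<Rightarrow> nat \<Rightarrow> real" and x :: "nat \<Rightarrow> nat \<Rightarrow> real"
  assumes unit: "\<And>i. i < n \<Longrightarrow> rowdot r (x i) (x i) = 1"
    and r: "r \<ge> 3"
    and sym: "\<And>i j. i < n \<Longrightarrow> j < n \<Longrightarrow> A i j = A j i"
    and rowsum: "\<And>i. i < n \<Longrightarrow> \<bar>\<Sum>j<n. A i j\<bar> \<le> D"
    and quad: "\<And>v. \<bar>\<Sum>i<n. \<Sum>j<n. A i j * v i * v j\<bar> \<le> N * (\<Sum>i<n. (v i)\<^sup>2)"
    and small: "(real r - 1) * D + (real r + 3) * N \<le> (real r - 3) * real n"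
    and so: "(\<Sum>i<n. \<Sum>j<n. (1 + A i j) * ((real r - 3) * (1 - rowdot r (x i) (x j)) +
        (1 - rowdot r (x i) (x j))\<^sup>2)) \<le> 0"
    and ij: "i < n" "j < n"
  shows "rowdot r (x i) (x j) = 1"
proof -
  define G where "G i j = rowdot r (x i) (x j)" for i j
  define H where "H i j = 1 - G i j" for i j
  define c where "c k = (\<Sum>i<n. x i k) / n" for k
  define a where "a i = (\<Sum>k<r. (x i k - c k)\<^sup>2)" for i
  define b where "b i = (\<Sum>(k, l)\<in>{..<r} \<times> {..<r}. (x i k * x i l - c k * c l)\<^sup>2)" for i
  define d where "d i = (\<Sum>j<n. A i j)" for i
  define R where "R = (\<Sum>k<r. \<Sum>i<n. \<Sum>j<n. A i j * (x i k - c k) * (x j k - c k))"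
  define T where "T = (\<Sum>(k, l)\<in>{..<r} \<times> {..<r}. \<Sum>i<n. \<Sum>j<n.
    A i j * (x i k * x i l - c k * c l) * (x j k * x j l - c k * c l))"
  have n: "n > 0" using ij by auto
  have D0: "D \<ge> 0" using rowsum[OF ij(1)] by linarith
  have N0: "N \<ge> 0"
  proof -
    have "\<bar>\<Sum>i<n. \<Sum>j<n. A i j * 1 * 1\<bar> \<le> N * (\<Sum>i<n. 1\<^sup>2)" by (rule quad)
    then have "0 \<le> N * real n" by simp
    then show ?thesis using n by (simp add: zero_le_mult_iff)
  qed
  have a0: "a i \<ge> 0" and b0: "b i \<ge> 0" for i
    unfolding a_def b_def by (auto intro!: sum_nonneg)
  have H2: "2 * H i j = (\<Sum>k<r. (x i k - x j k)\<^sup>2)" if "i < n" "j < n" for i j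
    unfolding sum_sq_diff H_def G_def using unit that by simp
  have sumH: "(\<Sum>i<n. \<Sum>j<n. H i j) = n * (\<Sum>i<n. a i)"
  proof -
    have "2 * (\<Sum>i<n. \<Sum>j<n. H i j) = (\<Sum>i<n. \<Sum>j<n. \<Sum>k<r. (x i k - x j k)\<^sup>2)"
      unfolding sum_distrib_left by (intro sum.cong refl H2) auto
    also have "\<dots> = (\<Sum>k<r. \<Sum>i<n. \<Sum>j<n. (x i k - x j k)\<^sup>2)"
      by (simp add: sum.swap[of _ "{..<r}"])
    also have "\<dots> = (\<Sum>k<r. 2 * real n * (\<Sum>i<n. (x i k - c k)\<^sup>2))"
      unfolding sum_sq_centred_pairs c_def ..
    also have "\<dots> = 2 * real n * (\<Sum>i<n. a i)"
      unfolding a_def sum_distrib_left[symmetric] by (simp add: sum.swap[of _ "{..<r}"])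
    finally show ?thesis by simp
  qed
  have AH: "(\<Sum>i<n. \<Sum>j<n. A i j * H i j) = (\<Sum>i<n. d i * a i) - R"
  proof -
    have "2 * (\<Sum>i<n. \<Sum>j<n. A i j * H i j) =
        (\<Sum>i<n. \<Sum>j<n. A i j * (\<Sum>k<r. (x i k - x j k)\<^sup>2))"
      unfolding sum_distrib_left by (intro sum.cong refl) (simp add: sum_distrib_left[symmetric] H2[symmetric])
    also have "\<dots> = 2 * (\<Sum>i<n. d i * a i) - 2 * R"
      unfolding d_def a_def R_def by (rule laplacian_form_family) (rule sym)
    finally show ?thesis by simp
  qed
  have AG: "(\<Sum>i<n. \<Sum>j<n. A i j * (1 - (G i j)\<^sup>2)) = (\<Sum>i<n. d i * b i) - T"
  proof -
    have "2 * (\<Sum>i<n. \<Sum>j<n. A i j * (1 - (G i j)\<^sup>2)) =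
        (\<Sum>i<n. \<Sum>j<n. A i j * (\<Sum>kl\<in>{..<r} \<times> {..<r}.
          (x i (fst kl) * x i (snd kl) - x j (fst kl) * x j (snd kl))\<^sup>2))"
      unfolding sum_distrib_left
      by (intro sum.cong refl)
        (simp add: sum_distrib_left[symmetric] sum_sq_diff_tensor[unfolded case_prod_unfold] unit G_def)
    also have "\<dots> = 2 * (\<Sum>i<n. d i * b i) - 2 * T"
      unfolding d_def b_def T_def case_prod_unfold by (rule laplacian_form_family) (rule sym)
    finally show ?thesis by simp
  qed
  have ba: "b i \<le> 4 * a i" if i: "i < n" for i
  proof -
    let ?p = "rowdot r (x i) c" and ?q = "rowdot r c c"
    have "?p\<^sup>2 \<le> ?q" using rowdot_Cauchy_Schwarz[of r "x i" c] unit[OF i] by simp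
    \<comment> \<open>the mean of unit vectors lies in the unit ball\<close>
    moreover have "?q \<le> 1"
    proof -
      have cx: "rowdot r c y = (\<Sum>i<n. rowdot r (x i) y) / n" for y
        unfolding rowdot_def c_def
        by (simp add: sum_divide_distrib sum_distrib_right sum.swap[of _ "{..<r}"])
      have "rowdot r (x i) c \<le> (1 + ?q) / 2" if "i < n" for i
      proof -
        have "0 \<le> (\<Sum>k<r. (x i k - c k)\<^sup>2)" by (simp add: sum_nonneg)
        then show ?thesis unfolding sum_sq_diff using unit[OF that] by simp
      qed
      then have "(\<Sum>i<n. rowdot r (x i) c) \<le> (\<Sum>i<n. (1 + ?q) / 2)" by (intro sum_mono) auto
      then have "n * ?q \<le> n * ((1 + ?q) / 2)" using n cx[of c] by (simp add: field_simps)
      then show ?thesis using n by (simp add: field_simps)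
    qed
    moreover have "a i = 1 - 2 * ?p + ?q" unfolding a_def sum_sq_diff using unit[OF i] by simp
    moreover have "b i = 1 - 2 * ?p\<^sup>2 + ?q\<^sup>2" unfolding b_def sum_sq_diff_tensor using unit[OF i] by simp
    ultimately show ?thesis using tensor_distance_le by simp
  qed
  have Rb: "\<bar>R\<bar> \<le> N * (\<Sum>i<n. a i)"
    unfolding R_def a_def by (rule quadratic_form_family_bound) (rule quad)
  have "\<bar>T\<bar> \<le> N * (\<Sum>i<n. b i)"
    unfolding T_def b_def case_prod_unfold by (rule quadratic_form_family_bound) (rule quad)
  also have "\<dots> \<le> N * (\<Sum>i<n. 4 * a i)" using ba N0 by (intro mult_left_mono sum_mono) auto
  finally have Tb: "\<bar>T\<bar> \<le> 4 * N * (\<Sum>i<n. a i)" by (simp flip: sum_distrib_left)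
  have diag: "- (\<Sum>i<n. d i * ((real r - 1) * a i - b i)) \<le> (real r - 1) * D * (\<Sum>i<n. a i)"
  proof -
    have "- (d i * ((real r - 1) * a i - b i)) \<le> (real r - 1) * D * a i" if i: "i < n" for i
    proof -
      have "2 * a i \<le> (real r - 1) * a i"
        using r a0[of i] by (intro mult_right_mono) auto
      then have "\<bar>(real r - 1) * a i - b i\<bar> \<le> (real r - 1) * a i"
        unfolding abs_le_iff using ba[OF i] b0[of i] by linarith
      then have "\<bar>d i\<bar> * \<bar>(real r - 1) * a i - b i\<bar> \<le> D * ((real r - 1) * a i)"
        using rowsum[OF i] by (intro mult_mono) (auto simp: d_def D0)
      then show ?thesis by (simp add: abs_le_iff mult_ac flip: abs_mult)
    qed
    then show ?thesis
      unfolding sum_distrib_left sum_negf[symmetric] by (intro sum_mono) auto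
  qed
  have "(\<Sum>i<n. \<Sum>j<n. (1 + A i j) * ((real r - 3) * H i j + (H i j)\<^sup>2)) =
    (\<Sum>i<n. \<Sum>j<n. (real r - 3) * H i j + (H i j)\<^sup>2 +
       ((real r - 1) * (A i j * H i j) - A i j * (1 - (G i j)\<^sup>2)))"
    by (intro sum.cong refl) (simp add: H_def power2_eq_square algebra_simps)
  also have "\<dots> = (real r - 3) * (\<Sum>i<n. \<Sum>j<n. H i j) + (\<Sum>i<n. \<Sum>j<n. (H i j)\<^sup>2)
     + (real r - 1) * (\<Sum>i<n. \<Sum>j<n. A i j * H i j) - (\<Sum>i<n. \<Sum>j<n. A i j * (1 - (G i j)\<^sup>2))"
    by (simp only: sum.distrib sum_subtractf sum_distrib_left[symmetric])
  finally have "(real r - 3) * (\<Sum>i<n. \<Sum>j<n. H i j) + (\<Sum>i<n. \<Sum>j<n. (H i j)\<^sup>2) \<le>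
     - ((real r - 1) * ((\<Sum>i<n. d i * a i) - R)) + ((\<Sum>i<n. d i * b i) - T)"
    using so unfolding AH AG H_def[symmetric, unfolded G_def] by (simp add: G_def H_def)
  also have "\<dots> = - (\<Sum>i<n. d i * ((real r - 1) * a i - b i)) + (real r - 1) * R - T"
    by (simp add: algebra_simps sum_subtractf sum.distrib sum_distrib_left)
  also have "\<dots> \<le> (real r - 1) * D * (\<Sum>i<n. a i) + (real r - 1) * (N * (\<Sum>i<n. a i))
      + 4 * N * (\<Sum>i<n. a i)"
  proof -
    have "(real r - 1) * R \<le> (real r - 1) * (N * (\<Sum>i<n. a i))"
      using Rb r by (intro mult_left_mono) auto
    then show ?thesis using diag Tb by linarith
  qed
  also have "\<dots> = ((real r - 1) * D + (real r + 3) * N) * (\<Sum>i<n. a i)" by (simp add: algebra_simps)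
  also have "\<dots> \<le> (real r - 3) * n * (\<Sum>i<n. a i)"
    using small a0 by (intro mult_right_mono sum_nonneg) auto
  finally have "(\<Sum>i<n. \<Sum>j<n. (H i j)\<^sup>2) \<le> 0" unfolding sumH by (simp add: mult.assoc)
  moreover have "(H i j)\<^sup>2 \<le> (\<Sum>j<n. (H i j)\<^sup>2)"
    using ij by (intro member_le_sum) auto
  moreover have "(\<Sum>j<n. (H i j)\<^sup>2) \<le> (\<Sum>i<n. \<Sum>j<n. (H i j)\<^sup>2)"
    using ij by (intro member_le_sum[of i "{..<n}" "\<lambda>i. \<Sum>j<n. (H i j)\<^sup>2"]) (auto intro: sum_nonneg)
  ultimately have "(H i j)\<^sup>2 \<le> 0" by linarith
  then show ?thesis by (simp add: H_def G_def)
qed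

section \<open>From the Hessian to the Gram matrix\<close>

lemma slack_mat_index:
  assumes C: "C \<in> carrier_mat n n" and Y: "Y \<in> carrier_mat n r" and i: "i < n" and j: "j < n"
  shows "slack_mat C Y $$ (i, j) =
    (if i = j then \<Sum>m<n. C $$ (i, m) * rowdot r (\<lambda>k. Y $$ (i, k)) (\<lambda>k. Y $$ (m, k)) else 0) - C $$ (i, j)"
proof -
  have CY: "C * Y \<in> carrier_mat n r" using C Y by auto
  have D: "C * Y * transpose_mat Y \<in> carrier_mat n n" using CY Y by auto
  have "(C * Y * transpose_mat Y) $$ (i, i) = (\<Sum>k<r. (\<Sum>m<n. C $$ (i, m) * Y $$ (m, k)) * Y $$ (i, k))"
    unfolding mult_transpose_index[OF CY Y i i] using i
    by (intro sum.cong refl) (simp add: mult_index[OF C Y] del: index_mult_mat)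
  also have "\<dots> = (\<Sum>m<n. C $$ (i, m) * rowdot r (\<lambda>k. Y $$ (i, k)) (\<lambda>k. Y $$ (m, k)))"
    unfolding rowdot_def sum_distrib_left sum_distrib_right
    by (subst sum.swap) (simp add: mult_ac)
  finally show ?thesis
    unfolding slack_mat_def using ddiag_index[OF D i j] ddiag_carrier[OF D] C i j
    by (cases "i = j") (simp_all del: index_mult_mat)
qed

text \<open>This is the trace of \<open>P\<^sub>x P\<^sub>y\<close>, where \<open>P\<^sub>x = I - x x\<^sup>T\<close> is the projection onto the
complement of the unit vector \<open>x\<close>.\<close>

lemma sum_projected_basis:
  fixes x y :: "nat \<Rightarrow> real"
  assumes "rowdot r x x = 1" "rowdot r y y = 1"
  shows "(\<Sum>k<r. \<Sum>l<r. ((if l = k then 1 else 0) - x k * x l) * ((if l = k then 1 else 0) - y k * y l)) =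
    real r - 2 + (rowdot r x y)\<^sup>2"
proof -
  have "(\<Sum>k<r. \<Sum>l<r. ((if l = k then 1 else 0) - x k * x l) * ((if l = k then 1 else 0) - y k * y l)) =
    (\<Sum>k<r. \<Sum>l<r. (if l = k then 1 - x l * x l - y l * y l else 0) + (x k * y k) * (x l * y l))"
    by (intro sum.cong refl) (auto simp: algebra_simps)
  also have "\<dots> = real r - rowdot r x x - rowdot r y y + rowdot r x y * rowdot r x y"
    unfolding rowdot_def sum_product by (simp add: sum.distrib sum_subtractf)
  finally show ?thesis using assms by (simp add: power2_eq_square)
qed

text \<open>Move all rows in one common direction, up to the signs \<open>z\<^sub>i\<close>: the direction \<open>V\<^sup>k\<close> has
rows \<open>z\<^sub>i P\<^sub>i e\<^sub>k\<close>, where \<open>P\<^sub>i\<close> projects onto the tangent space of the sphere at row \<open>i\<close>. Adding up the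
second-order conditions over an orthonormal basis \<open>e\<^sub>k\<close> replaces \<open>\<langle>V\<^sub>i, V\<^sub>j\<rangle>\<close> by
\<open>z\<^sub>i z\<^sub>j (r - 2 + \<langle>y\<^sub>i, y\<^sub>j\<rangle>\<^sup>2)\<close>, and \<open>(r - 3) (1 - G) + (1 - G)\<^sup>2 = (r - 2) - (r - 1) G + G\<^sup>2\<close>.\<close>

lemma second_order_inequality:
  assumes C: "C \<in> carrier_mat n n" and sym: "transpose_mat C = C"
    and soc: "second_order_critical n r (objective C) Y"
    and z: "\<And>i. i < n \<Longrightarrow> z $ i \<in> {1, -1 :: real}"
  defines "G \<equiv> \<lambda>i j. rowdot r (\<lambda>k. z $ i * Y $$ (i, k)) (\<lambda>k. z $ j * Y $$ (j, k))"
  shows "(\<Sum>i<n. \<Sum>j<n. z $ i * z $ j * C $$ (i, j) *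
    ((real r - 3) * (1 - G i j) + (1 - G i j)\<^sup>2)) \<le> 0"
proof -
  have feas: "Y \<in> feasible n r"
    and pos: "\<And>V. V \<in> tangent_space n r Y \<Longrightarrow> frob_inner (slack_mat C Y) (V * transpose_mat V) \<ge> 0"
    using soc unfolding second_order_critical_objective_iff[OF C sym] by auto
  have Y: "Y \<in> carrier_mat n r"
    and unit: "\<And>i. i < n \<Longrightarrow> rowdot r (\<lambda>k. Y $$ (i, k)) (\<lambda>k. Y $$ (i, k)) = 1"
    using feas by (auto simp: feasible_iff rowdot_def power2_eq_square)
  define g where "g i j = rowdot r (\<lambda>k. Y $$ (i, k)) (\<lambda>k. Y $$ (j, k))" for i j
  have Gg: "G i j = z $ i * z $ j * g i j" for i j
    unfolding G_def g_def rowdot_def sum_distrib_left by (simp add: mult_ac)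
  define V where "V k = mat n r (\<lambda>(i, l). z $ i * ((if l = k then 1 else 0) - Y $$ (i, k) * Y $$ (i, l)))" for k
  have V: "V k \<in> carrier_mat n r" for k by (simp add: V_def)
  have Vix: "V k $$ (i, l) = z $ i * ((if l = k then 1 else 0) - Y $$ (i, k) * Y $$ (i, l))"
    if "i < n" "l < r" for i k l using that by (simp add: V_def)
  have S: "slack_mat C Y \<in> carrier_mat n n" by (rule slack_mat_carrier[OF C Y])
  have tangent: "V k \<in> tangent_space n r Y" if k: "k < r" for k
    unfolding tangent_space_iff[OF Y]
  proof (intro conjI allI impI V)
    fix i assume i: "i < n"
    have "(\<Sum>l<r. Y $$ (i, l) * V k $$ (i, l)) =
      (\<Sum>l<r. (if l = k then z $ i * Y $$ (i, l) else 0) - z $ i * Y $$ (i, k) * (Y $$ (i, l) * Y $$ (i, l)))"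
      using i by (intro sum.cong refl) (simp add: Vix algebra_simps)
    also have "\<dots> = z $ i * Y $$ (i, k) - z $ i * Y $$ (i, k) * rowdot r (\<lambda>k. Y $$ (i, k)) (\<lambda>k. Y $$ (i, k))"
      unfolding rowdot_def using k by (simp add: sum_subtractf sum_distrib_left)
    finally show "(\<Sum>l<r. Y $$ (i, l) * V k $$ (i, l)) = 0" using unit[OF i] by simp
  qed
  have "0 \<le> (\<Sum>k<r. frob_inner (slack_mat C Y) (V k * transpose_mat (V k)))"
    using tangent pos by (intro sum_nonneg) auto
  also have "\<dots> = (\<Sum>k<r. \<Sum>i<n. \<Sum>j<n. slack_mat C Y $$ (i, j) * (\<Sum>l<r. V k $$ (i, l) * V k $$ (j, l)))"
  proof (intro sum.cong refl)
    fix k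
    have VV: "V k * transpose_mat (V k) \<in> carrier_mat n n" using V[of k] by auto
    show "frob_inner (slack_mat C Y) (V k * transpose_mat (V k)) =
      (\<Sum>i<n. \<Sum>j<n. slack_mat C Y $$ (i, j) * (\<Sum>l<r. V k $$ (i, l) * V k $$ (j, l)))"
      unfolding frob_inner_eq_sum[OF S VV]
      by (intro sum.cong refl) (simp add: mult_transpose_index[OF V V] del: index_mult_mat)
  qed
  also have "\<dots> = (\<Sum>i<n. \<Sum>j<n. slack_mat C Y $$ (i, j) * (\<Sum>k<r. \<Sum>l<r. V k $$ (i, l) * V k $$ (j, l)))"
    by (subst sum_rotate) (simp add: sum_distrib_left)
  also have "\<dots> = (\<Sum>i<n. \<Sum>j<n. slack_mat C Y $$ (i, j) * (z $ i * z $ j * (real r - 2 + (g i j)\<^sup>2)))"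
  proof (intro sum.cong refl, rule arg_cong[where f = "(*) _"])
    fix i j assume "i \<in> {..<n}" "j \<in> {..<n}"
    then have i: "i < n" and j: "j < n" by auto
    have "(\<Sum>k<r. \<Sum>l<r. V k $$ (i, l) * V k $$ (j, l)) = z $ i * z $ j * (\<Sum>k<r. \<Sum>l<r.
      ((if l = k then 1 else 0) - Y $$ (i, k) * Y $$ (i, l)) * ((if l = k then 1 else 0) - Y $$ (j, k) * Y $$ (j, l)))"
      unfolding sum_distrib_left using i j by (intro sum.cong refl) (simp add: Vix)
    then show "(\<Sum>k<r. \<Sum>l<r. V k $$ (i, l) * V k $$ (j, l)) = z $ i * z $ j * (real r - 2 + (g i j)\<^sup>2)"
      unfolding g_def sum_projected_basis[OF unit[OF i] unit[OF j]] .
  qed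
  also have "\<dots> = (\<Sum>i<n. \<Sum>j<n. (if i = j then (real r - 1) * (\<Sum>m<n. C $$ (i, m) * g i m) else 0) -
      C $$ (i, j) * (z $ i * z $ j * (real r - 2 + (g i j)\<^sup>2)))"
  proof (intro sum.cong refl)
    fix i j assume "i \<in> {..<n}" "j \<in> {..<n}"
    then have i: "i < n" and j: "j < n" by auto
    have zz: "z $ j * z $ j = 1" using z[OF j] by auto
    have gg: "g j j = 1" using unit[OF j] by (simp add: g_def)
    show "slack_mat C Y $$ (i, j) * (z $ i * z $ j * (real r - 2 + (g i j)\<^sup>2)) =
      (if i = j then (real r - 1) * (\<Sum>m<n. C $$ (i, m) * g i m) else 0) -
      C $$ (i, j) * (z $ i * z $ j * (real r - 2 + (g i j)\<^sup>2))"
      unfolding slack_mat_index[OF C Y i j] g_def[symmetric]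
    proof (cases "i = j")
      case True
      show "((if i = j then \<Sum>m<n. C $$ (i, m) * g i m else 0) - C $$ (i, j)) *
          (z $ i * z $ j * (real r - 2 + (g i j)\<^sup>2)) =
        (if i = j then (real r - 1) * (\<Sum>m<n. C $$ (i, m) * g i m) else 0) -
          C $$ (i, j) * (z $ i * z $ j * (real r - 2 + (g i j)\<^sup>2))"
        unfolding True zz gg by (simp add: algebra_simps)
    qed simp
  qed
  also have "\<dots> = (\<Sum>i<n. \<Sum>j<n. (real r - 1) * (C $$ (i, j) * g i j) -
      C $$ (i, j) * (z $ i * z $ j * (real r - 2 + (g i j)\<^sup>2)))"
    by (simp add: sum_subtractf sum_distrib_left)
  also have "\<dots> = - (\<Sum>i<n. \<Sum>j<n. z $ i * z $ j * C $$ (i, j) *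
    ((real r - 3) * (1 - G i j) + (1 - G i j)\<^sup>2))"
    unfolding sum_negf[symmetric]
  proof (intro sum.cong refl)
    fix i j assume "i \<in> {..<n}" "j \<in> {..<n}"
    then have "z $ i \<in> {1, -1}" "z $ j \<in> {1, -1}" using z by auto
    then show "(real r - 1) * (C $$ (i, j) * g i j) - C $$ (i, j) * (z $ i * z $ j * (real r - 2 + (g i j)\<^sup>2)) =
      - (z $ i * z $ j * C $$ (i, j) * ((real r - 3) * (1 - G i j) + (1 - G i j)\<^sup>2))"
      unfolding Gg by (auto simp: power2_eq_square algebra_simps)
  qed
  finally show ?thesis by simp
qed

text \<open>The entrywise form of \<open>Y = z u\<^sup>T\<close>; it avoids the quantifier over \<open>u\<close> and is a closed condition
on \<open>Y\<close>.\<close>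

definition aligned :: "nat \<Rightarrow> nat \<Rightarrow> real vec \<Rightarrow> real mat \<Rightarrow> bool" where
  "aligned n r z Y \<longleftrightarrow> (\<forall>i<n. \<forall>j<n. \<forall>k<r. z $ i * Y $$ (i, k) = z $ j * Y $$ (j, k))"

lemma aligned_iff_outer_prod:
  assumes feas: "Y \<in> feasible n r" and n: "n > 0" and zc: "z \<in> carrier_vec n"
    and z: "\<And>i. i < n \<Longrightarrow> z $ i \<in> {1, -1 :: real}"
  shows "(\<exists>u \<in> carrier_vec r. sqrt (u \<bullet> u) = 1 \<and> Y = outer_prod z u) \<longleftrightarrow> aligned n r z Y"
proof
  have Y: "Y \<in> carrier_mat n r" and unit: "\<And>i. i < n \<Longrightarrow> (\<Sum>k<r. (Y $$ (i, k))\<^sup>2) = 1"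
    using feas by (auto simp: feasible_iff)
  have zz: "z $ i * (z $ i * a) = a" if "i < n" for i a using z[OF that] by auto
  {
    assume "\<exists>u \<in> carrier_vec r. sqrt (u \<bullet> u) = 1 \<and> Y = outer_prod z u"
    then obtain u where u: "u \<in> carrier_vec r" and Yu: "Y = outer_prod z u" by auto
    have zY: "z $ i * Y $$ (i, k) = u $ k" if "i < n" "k < r" for i k
      using that u zc by (simp add: Yu outer_prod_def zz)
    show "aligned n r z Y"
      unfolding aligned_def by (intro allI impI) (simp only: zY)
  }
  assume al: "aligned n r z Y"
  define u where "u = vec r (\<lambda>k. z $ 0 * Y $$ (0, k))"
  have u_carrier: "u \<in> carrier_vec r" by (simp add: u_def)
  have "u \<bullet> u = (\<Sum>k<r. (z $ 0 * Y $$ (0, k))\<^sup>2)"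
    by (simp add: u_def scalar_prod_def atLeast0LessThan power2_eq_square)
  also have "\<dots> = 1" using z[OF n] unit[OF n] by (auto simp: power_mult_distrib)
  finally have "sqrt (u \<bullet> u) = 1" by simp
  moreover have "Y = outer_prod z u"
  proof (rule eq_matI)
    fix i k assume "i < dim_row (outer_prod z u)" "k < dim_col (outer_prod z u)"
    then have i: "i < n" and k: "k < r" using zc by (auto simp: outer_prod_def u_def)
    have "z $ 0 * Y $$ (0, k) = z $ i * Y $$ (i, k)" by (rule al[unfolded aligned_def, rule_format, OF n i k])
    then show "Y $$ (i, k) = outer_prod z u $$ (i, k)"
      using i k zc by (simp add: outer_prod_def u_def zz)
  qed (use Y zc in \<open>auto simp: outer_prod_def u_def\<close>)
  ultimately show "\<exists>u \<in> carrier_vec r. sqrt (u \<bullet> u) = 1 \<and> Y = outer_prod z u"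
    using u_carrier by blast
qed

text \<open>The matrix \<open>A\<close> is the noise seen after conjugating by the signs \<open>z\<close>, which turns the signal
\<open>z z\<^sup>T\<close> into the all-ones matrix. Its diagonal is set to zero because \<open>1 - G\<^sub>i\<^sub>i = 0\<close>.\<close>

lemma second_order_critical_aligned:
  assumes C: "C \<in> carrier_mat n n" and sym: "transpose_mat C = C"
    and z: "\<And>i. i < n \<Longrightarrow> z $ i \<in> {1, -1 :: real}"
    and soc: "second_order_critical n r (objective C) Y"
    and r: "r \<ge> 3"
  defines "A \<equiv> \<lambda>i j. if i = j then 0 else z $ i * z $ j * C $$ (i, j) - 1"
  assumes rowsum: "\<And>i. i < n \<Longrightarrow> \<bar>\<Sum>j<n. A i j\<bar> \<le> D"
    and quad: "\<And>v. \<bar>\<Sum>i<n. \<Sum>j<n. A i j * v i * v j\<bar> \<le> N * (\<Sum>i<n. (v i)\<^sup>2)"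
    and small: "(real r - 1) * D + (real r + 3) * N \<le> (real r - 3) * real n"
  shows "aligned n r z Y"
proof -
  define x where "x i k = z $ i * Y $$ (i, k)" for i k
  have feas: "Y \<in> feasible n r" using soc by (simp add: second_order_critical_def)
  have unit: "rowdot r (x i) (x i) = 1" if "i < n" for i
    using feas z[OF that] that by (auto simp: feasible_iff rowdot_def x_def power2_eq_square)
  have Csym: "C $$ (i, j) = C $$ (j, i)" if "i < n" "j < n" for i j
    using that C sym by (metis carrier_matD index_transpose_mat(1))
  have Asym: "A i j = A j i" if "i < n" "j < n" for i j
    unfolding A_def using Csym[OF that] by simp
  have "(\<Sum>i<n. \<Sum>j<n. z $ i * z $ j * C $$ (i, j) *
    ((real r - 3) * (1 - rowdot r (x i) (x j)) + (1 - rowdot r (x i) (x j))\<^sup>2)) \<le> 0"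
    using second_order_inequality[OF C sym soc z] by (simp add: x_def[abs_def])
  also have "(\<Sum>i<n. \<Sum>j<n. z $ i * z $ j * C $$ (i, j) *
    ((real r - 3) * (1 - rowdot r (x i) (x j)) + (1 - rowdot r (x i) (x j))\<^sup>2)) =
    (\<Sum>i<n. \<Sum>j<n. (1 + A i j) *
    ((real r - 3) * (1 - rowdot r (x i) (x j)) + (1 - rowdot r (x i) (x j))\<^sup>2))"
    by (intro sum.cong refl) (auto simp: A_def unit)
  finally have so: "\<dots> \<le> 0" .
  have "z $ i * Y $$ (i, k) = z $ j * Y $$ (j, k)" if ij: "i < n" "j < n" and k: "k < r" for i j k
  proof -
    have "rowdot r (x i) (x j) = 1"
      by (rule rows_agree[OF unit r Asym rowsum quad small so ij])
    then have "(\<Sum>k<r. (x i k - x j k)\<^sup>2) = 0"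
      unfolding sum_sq_diff using unit ij by simp
    then have "x i k = x j k" using k by (subst (asm) sum_nonneg_eq_0_iff) auto
    then show ?thesis unfolding x_def .
  qed
  then show ?thesis unfolding aligned_def by blast
qed

section \<open>Tails of Gaussian linear forms\<close>

lemma normal_exponential_moment:
  fixes s :: real
  shows "integrable lborel (\<lambda>x. std_normal_density x * exp (s * x))"
    and "(\<integral>x. std_normal_density x * exp (s * x) \<partial>lborel) = exp (s\<^sup>2 / 2)"
proof -
  have "std_normal_density x * exp (s * x) = exp (s\<^sup>2 / 2) * normal_density s 1 x" for x
    by (simp add: normal_density_def power2_eq_square algebra_simps diff_divide_distrib
        add_divide_distrib flip: exp_add)
  then show "integrable lborel (\<lambda>x. std_normal_density x * exp (s * x))"
    and "(\<integral>x. std_normal_density x * exp (s * x) \<partial>lborel) = exp (s\<^sup>2 / 2)"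
    by simp_all
qed

context prob_space
begin

lemma std_normal_exp_moment:
  assumes "distributed M lborel X std_normal_density"
  shows "integrable M (\<lambda>\<omega>. exp (s * X \<omega>))" and "expectation (\<lambda>\<omega>. exp (s * X \<omega>)) = exp (s\<^sup>2 / 2)"
proof -
  have "(\<lambda>x. exp (s * x)) \<in> borel_measurable lborel" by measurable
  then show "integrable M (\<lambda>\<omega>. exp (s * X \<omega>))" and "expectation (\<lambda>\<omega>. exp (s * X \<omega>)) = exp (s\<^sup>2 / 2)"
    using normal_exponential_moment[of s]
      distributed_integrable[OF assms, of "\<lambda>x. exp (s * x)"]
      distributed_integral[OF assms, of "\<lambda>x. exp (s * x)"]
    by auto
qed

text \<open>Chernoff's bound with the optimal parameter \<open>t / v\<close>; the exponential moment of the form factors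
by independence.\<close>

lemma gaussian_linear_form_upper_tail:
  fixes X :: "'i \<Rightarrow> 'a \<Rightarrow> real"
  assumes I: "finite I"
    and indep: "indep_vars (\<lambda>_. borel) X I"
    and normal: "\<And>i. i \<in> I \<Longrightarrow> distributed M lborel (X i) std_normal_density"
    and v: "(\<Sum>i\<in>I. (c i)\<^sup>2) \<le> v" "v > 0" and t: "t > 0"
  shows "prob {\<omega> \<in> space M. (\<Sum>i\<in>I. c i * X i \<omega>) \<ge> t} \<le> exp (- (t\<^sup>2 / (2 * v)))"
proof -
  define s where "s = t / v"
  have s: "s > 0" using v t by (simp add: s_def)
  have ind: "indep_vars (\<lambda>_. borel) (\<lambda>i \<omega>. exp (s * c i * X i \<omega>)) I"
    by (rule indep_vars_compose2[OF indep]) measurable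
  have int: "integrable M (\<lambda>\<omega>. exp (s * c i * X i \<omega>))" if "i \<in> I" for i
    using std_normal_exp_moment(1)[OF normal[OF that]] .
  have exp_linear: "exp (s * (\<Sum>i\<in>I. c i * X i \<omega>)) = (\<Prod>i\<in>I. exp (s * c i * X i \<omega>))" for \<omega>
    using I by (simp add: exp_sum sum_distrib_left mult.assoc)
  have "integrable M (\<lambda>\<omega>. exp (s * (\<Sum>i\<in>I. c i * X i \<omega>)))"
    unfolding exp_linear by (rule indep_vars_integrable[OF I ind int])
  then have "set_integrable M (space M) (\<lambda>\<omega>. exp (s * (\<Sum>i\<in>I. c i * X i \<omega>)))"
    unfolding set_integrable_def by (rule integrable_mult_indicator[OF sets.top])
  from Chernoff_ineq_ge[OF s this sets.top, of t]
  have "prob {\<omega> \<in> space M. (\<Sum>i\<in>I. c i * X i \<omega>) \<ge> t} \<le>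
    exp (- s * t) * expectation (\<lambda>\<omega>. exp (s * (\<Sum>i\<in>I. c i * X i \<omega>)))"
    by (simp add: set_integral_space[OF \<open>integrable M _\<close>])
  also have "expectation (\<lambda>\<omega>. exp (s * (\<Sum>i\<in>I. c i * X i \<omega>))) =
      (\<Prod>i\<in>I. expectation (\<lambda>\<omega>. exp (s * c i * X i \<omega>)))"
    unfolding exp_linear by (rule indep_vars_lebesgue_integral[OF I ind int])
  also have "\<dots> = (\<Prod>i\<in>I. exp ((s * c i)\<^sup>2 / 2))"
    by (intro prod.cong refl std_normal_exp_moment(2) normal)
  also have "\<dots> = exp (s\<^sup>2 * (\<Sum>i\<in>I. (c i)\<^sup>2) / 2)"
    unfolding exp_sum[OF I, symmetric]
    by (simp add: sum_distrib_left sum_divide_distrib power_mult_distrib)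
  also have "exp (- s * t) * \<dots> \<le> exp (- s * t) * exp (s\<^sup>2 * v / 2)"
    using v by (intro mult_left_mono) (auto intro!: divide_right_mono mult_left_mono)
  also have "\<dots> = exp (- (t\<^sup>2 / (2 * v)))"
    using v by (simp add: s_def power2_eq_square field_simps flip: exp_add)
  finally show ?thesis .
qed

lemma gaussian_linear_form_tail:
  fixes X :: "'i \<Rightarrow> 'a \<Rightarrow> real"
  assumes I: "finite I"
    and indep: "indep_vars (\<lambda>_. borel) X I"
    and normal: "\<And>i. i \<in> I \<Longrightarrow> distributed M lborel (X i) std_normal_density"
    and v: "(\<Sum>i\<in>I. (c i)\<^sup>2) \<le> v" "v > 0" and t: "t > 0"
  shows "prob {\<omega> \<in> space M. \<bar>\<Sum>i\<in>I. c i * X i \<omega>\<bar> \<ge> t} \<le> 2 * exp (- (t\<^sup>2 / (2 * v)))"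
proof -
  have [measurable]: "X i \<in> borel_measurable M" if "i \<in> I" for i
    using indep that by (simp add: indep_vars_def)
  have "prob {\<omega> \<in> space M. \<bar>\<Sum>i\<in>I. c i * X i \<omega>\<bar> \<ge> t} \<le>
    prob ({\<omega> \<in> space M. (\<Sum>i\<in>I. c i * X i \<omega>) \<ge> t} \<union> {\<omega> \<in> space M. (\<Sum>i\<in>I. - c i * X i \<omega>) \<ge> t})"
    by (intro finite_measure_mono) (auto simp: sum_negf abs_if split: if_splits)
  also have "\<dots> \<le> prob {\<omega> \<in> space M. (\<Sum>i\<in>I. c i * X i \<omega>) \<ge> t} +
      prob {\<omega> \<in> space M. (\<Sum>i\<in>I. - c i * X i \<omega>) \<ge> t}"
    by (intro measure_Un_le) measurable
  also have "\<dots> \<le> exp (- (t\<^sup>2 / (2 * v))) + exp (- (t\<^sup>2 / (2 * v)))"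
    using v t by (intro add_mono gaussian_linear_form_upper_tail[OF I indep normal]) auto
  finally show ?thesis by simp
qed

end

section \<open>Quadratic forms and lattice points\<close>

definition quad_form :: "nat \<Rightarrow> (nat \<Rightarrow> nat \<Rightarrow> real) \<Rightarrow> (nat \<Rightarrow> real) \<Rightarrow> real" where
  "quad_form n B x = (\<Sum>i<n. \<Sum>j<n. B i j * x i * x j)"

definition lattice_ball :: "nat \<Rightarrow> real \<Rightarrow> (nat \<Rightarrow> int) set" where
  "lattice_ball n \<rho> = {k \<in> {..<n} \<rightarrow>\<^sub>E UNIV. (\<Sum>i<n. (real_of_int (k i))\<^sup>2) \<le> \<rho>}"

text \<open>A geometric series: the sum over the positive integers is bounded by \<open>\<Sum> 2\<^sup>-\<^sup>j = 1\<close>.\<close>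

lemma sum_exp_neg_abs_int: "(\<Sum>j\<in>{-int m..int m}. exp (- \<bar>real_of_int j\<bar>)) \<le> 3"
proof -
  have exp1: "exp (- 1) \<le> (1 / 2 :: real)"
    using exp_ge_add_one_self[of 1] by (simp add: exp_minus field_simps)
  have geo: "(\<Sum>i<m. exp (- (real i + 1))) \<le> 1 - (1 / 2) ^ m" for m :: nat
  proof (induction m)
    case (Suc m)
    have "exp (- (real m + 1)) = exp (-1) ^ Suc m"
      unfolding exp_of_nat_mult[symmetric] by (simp add: algebra_simps)
    also have "\<dots> \<le> (1 / 2) ^ Suc m" by (intro power_mono exp1) simp
    finally show ?case using Suc by simp
  qed simp
  have "(\<Sum>j\<in>{-int m..int m}. exp (- \<bar>real_of_int j\<bar>)) = 1 + 2 * (\<Sum>i<m. exp (- (real i + 1)))"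
  proof (induction m)
    case (Suc m)
    have "{- int (Suc m)..int (Suc m)} = insert (- int m - 1) (insert (int m + 1) {-int m..int m})"
      by auto
    then have "(\<Sum>j\<in>{-int (Suc m)..int (Suc m)}. exp (- \<bar>real_of_int j\<bar>)) =
      2 * exp (- (real m + 1)) + (\<Sum>j\<in>{-int m..int m}. exp (- \<bar>real_of_int j\<bar>))"
      by simp
    then show ?case using Suc by simp
  qed simp
  also have "\<dots> \<le> 1 + 2 * 1" using geo[of m] by (smt (verit) zero_le_power divide_nonneg_nonneg)
  finally show ?thesis by simp
qed

text \<open>Every lattice point of the ball has weight at least one under
\<open>k \<mapsto> exp (\<rho> - \<Sum>|k\<^sub>i|)\<close>, because \<open>|k\<^sub>i| \<le> k\<^sub>i\<^sup>2\<close> for integers, and the total weight factors over the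
coordinates. A count of the enclosing box alone would be of order \<open>\<rho>\<close> to the power \<open>n / 2\<close>, which is too
large for the union bound.\<close>

lemma
  assumes "\<rho> \<ge> 0"
  shows finite_lattice_ball: "finite (lattice_ball n \<rho>)"
    and card_lattice_ball_le: "real (card (lattice_ball n \<rho>)) \<le> exp \<rho> * 3 ^ n"
proof -
  obtain m :: nat where m: "\<rho> \<le> real m" using real_arch_simple by blast
  define P where "P = ({..<n} \<rightarrow>\<^sub>E {-int m..int m})"
  have fin: "finite P" unfolding P_def by (intro finite_PiE) auto
  have abs_le_sq: "\<bar>real_of_int j\<bar> \<le> (real_of_int j)\<^sup>2" for j
  proof (cases "j = 0")
    case False
    then have "1 \<le> \<bar>real_of_int j\<bar>" by linarith
    then show ?thesis using mult_left_mono[of 1 "\<bar>real_of_int j\<bar>" "\<bar>real_of_int j\<bar>"] by (simp add: power2_eq_square)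
  qed simp
  have sub: "lattice_ball n \<rho> \<subseteq> P"
  proof
    fix k assume k: "k \<in> lattice_ball n \<rho>"
    have "\<bar>k i\<bar> \<le> int m" if i: "i < n" for i
    proof -
      have "(real_of_int (k i))\<^sup>2 \<le> (\<Sum>i<n. (real_of_int (k i))\<^sup>2)"
        using i by (intro member_le_sum) auto
      then have "\<bar>real_of_int (k i)\<bar> \<le> real m"
        using k m abs_le_sq[of "k i"] by (simp add: lattice_ball_def)
      then show ?thesis by linarith
    qed
    then show "k \<in> P" using k by (auto simp: P_def lattice_ball_def PiE_iff abs_le_iff minus_le_iff)
  qed
  then show f: "finite (lattice_ball n \<rho>)" using fin by (rule finite_subset)
  have "real (card (lattice_ball n \<rho>)) = (\<Sum>k\<in>lattice_ball n \<rho>. 1)" by simp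
  also have "\<dots> \<le> (\<Sum>k\<in>lattice_ball n \<rho>. exp (\<rho> - (\<Sum>i<n. \<bar>real_of_int (k i)\<bar>)))"
  proof (intro sum_mono)
    fix k assume "k \<in> lattice_ball n \<rho>"
    moreover have "(\<Sum>i<n. \<bar>real_of_int (k i)\<bar>) \<le> (\<Sum>i<n. (real_of_int (k i))\<^sup>2)"
      by (intro sum_mono abs_le_sq)
    ultimately show "1 \<le> exp (\<rho> - (\<Sum>i<n. \<bar>real_of_int (k i)\<bar>))"
      by (simp add: lattice_ball_def)
  qed
  also have "\<dots> \<le> (\<Sum>k\<in>P. exp (\<rho> - (\<Sum>i<n. \<bar>real_of_int (k i)\<bar>)))"
    using sub fin by (intro sum_mono2) auto
  also have "\<dots> = exp \<rho> * (\<Sum>k\<in>P. \<Prod>i<n. exp (- \<bar>real_of_int (k i)\<bar>))"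
    unfolding sum_distrib_left
    by (intro sum.cong refl) (simp add: exp_sum[symmetric] sum_negf exp_add[symmetric])
  also have "(\<Sum>k\<in>P. \<Prod>i<n. exp (- \<bar>real_of_int (k i)\<bar>)) =
      (\<Prod>i<n. \<Sum>j\<in>{-int m..int m}. exp (- \<bar>real_of_int j\<bar>))"
    unfolding P_def by (rule prod_sum_PiE[symmetric]) auto
  also have "\<dots> \<le> 3 ^ n"
    using sum_exp_neg_abs_int[of m] by (simp add: power_mono sum_nonneg)
  finally show "real (card (lattice_ball n \<rho>)) \<le> exp \<rho> * 3 ^ n" by simp
qed

text \<open>The lattice plays the part of an \<open>\<epsilon>\<close>-net. Let \<open>s\<close> be the supremum of \<open>|q|\<close> over the ball
\<open>|x|\<^sup>2 \<le> n\<close>. Rounding \<open>8 x\<close> towards zero gives a lattice point \<open>k\<close> with \<open>|k|\<^sup>2 \<le> 64 n\<close> and an error \<open>e\<close> in the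
same ball as \<open>x\<close>. Expanding, \<open>64 q(x) = q(k) + 16 b(x, e) - q(e)\<close>, where the polar form satisfies
\<open>|b(x, e)| \<le> 2 s\<close>; hence \<open>64 s \<le> t + 33 s\<close>. Scaling by 4 would not suffice for this argument, as
\<open>16 \<le> 8 \<cdot> 2 + 1\<close>.\<close>

lemma abs_quad_form_le_of_lattice:
  assumes sym: "\<And>i j. i < n \<Longrightarrow> j < n \<Longrightarrow> B i j = B j i"
    and net: "\<And>k. k \<in> lattice_ball n (64 * real n) \<Longrightarrow> \<bar>quad_form n B (\<lambda>i. real_of_int (k i))\<bar> \<le> t"
    and n: "n > 0"
  shows "\<bar>quad_form n B x\<bar> \<le> t / (31 * real n) * (\<Sum>i<n. (x i)\<^sup>2)"
proof -
  define S where "S = {x :: nat \<Rightarrow> real. (\<Sum>i<n. (x i)\<^sup>2) \<le> real n}"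
  define s where "s = (SUP x\<in>S. \<bar>quad_form n B x\<bar>)"
  have bdd: "bdd_above ((\<lambda>x. \<bar>quad_form n B x\<bar>) ` S)"
  proof (rule bdd_aboveI2)
    fix x assume x: "x \<in> S"
    have xi: "\<bar>x i\<bar> \<le> sqrt n" if "i < n" for i
    proof -
      have "(x i)\<^sup>2 \<le> (\<Sum>i<n. (x i)\<^sup>2)" using that by (intro member_le_sum) auto
      then show ?thesis using x by (auto simp: S_def intro: real_le_rsqrt)
    qed
    have "\<bar>quad_form n B x\<bar> \<le> (\<Sum>i<n. \<Sum>j<n. \<bar>B i j * x i * x j\<bar>)"
      unfolding quad_form_def
      by (rule order.trans[OF sum_abs], rule sum_mono, rule sum_abs)
    also have "\<dots> \<le> (\<Sum>i<n. \<Sum>j<n. \<bar>B i j\<bar> * sqrt n * sqrt n)"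
      unfolding abs_mult by (intro sum_mono mult_mono xi) auto
    finally show "\<bar>quad_form n B x\<bar> \<le> (\<Sum>i<n. \<Sum>j<n. \<bar>B i j\<bar> * sqrt n * sqrt n)" .
  qed
  have le_s: "\<bar>quad_form n B x\<bar> \<le> s" if "x \<in> S" for x
    unfolding s_def by (rule cSUP_upper[OF that bdd])
  have half: "(\<lambda>i. (x i + y i) / 2) \<in> S" "(\<lambda>i. (x i - y i) / 2) \<in> S" if "x \<in> S" "y \<in> S" for x y
  proof -
    have *: "(\<Sum>i<n. ((x i + w * y i) / 2)\<^sup>2) \<le> real n" if w: "w\<^sup>2 = 1" for w
    proof -
      have "((x i + w * y i) / 2)\<^sup>2 \<le> ((x i)\<^sup>2 + (y i)\<^sup>2) / 2" for i
      proof -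
        have "((x i + w * y i) / 2)\<^sup>2 + ((x i - w * y i) / 2)\<^sup>2 = ((x i)\<^sup>2 + w\<^sup>2 * (y i)\<^sup>2) / 2"
          by (simp add: power2_eq_square field_simps)
        moreover have "0 \<le> ((x i - w * y i) / 2)\<^sup>2" by (rule zero_le_power2)
        ultimately show ?thesis unfolding w mult_1 by linarith
      qed
      then have "(\<Sum>i<n. ((x i + w * y i) / 2)\<^sup>2) \<le> (\<Sum>i<n. ((x i)\<^sup>2 + (y i)\<^sup>2) / 2)"
        by (intro sum_mono)
      also have "\<dots> \<le> real n"
        using that \<open>x \<in> S\<close> \<open>y \<in> S\<close> by (simp add: S_def sum.distrib flip: sum_divide_distrib)
      finally show ?thesis .
    qed
    show "(\<lambda>i. (x i + y i) / 2) \<in> S" "(\<lambda>i. (x i - y i) / 2) \<in> S"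
      using *[of 1] *[of "-1"] by (simp_all add: S_def)
  qed
  have split: "64 * quad_form n B x = quad_form n B (\<lambda>i. 8 * x i - e i) +
      16 * (quad_form n B (\<lambda>i. (x i + e i) / 2) - quad_form n B (\<lambda>i. (x i - e i) / 2)) - quad_form n B e"
    for x e
  proof -
    have sw: "(\<Sum>i<n. \<Sum>j<n. B i j * e i * x j) = (\<Sum>i<n. \<Sum>j<n. B i j * x i * e j)"
      by (subst sum.swap) (intro sum.cong refl, simp add: sym)
    have "quad_form n B (\<lambda>i. 8 * x i - e i) =
        (\<Sum>i<n. \<Sum>j<n. 64 * (B i j * x i * x j) - 8 * (B i j * x i * e j) - 8 * (B i j * e i * x j) + B i j * e i * e j)"
      unfolding quad_form_def by (intro sum.cong refl) (simp add: algebra_simps)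
    also have "\<dots> = 64 * quad_form n B x - 16 * (\<Sum>i<n. \<Sum>j<n. B i j * x i * e j) + quad_form n B e"
      unfolding quad_form_def sum.distrib sum_subtractf sum_distrib_left[symmetric] sw by simp
    finally have 1: "quad_form n B (\<lambda>i. 8 * x i - e i) = \<dots>" .
    have "quad_form n B (\<lambda>i. (x i + e i) / 2) - quad_form n B (\<lambda>i. (x i - e i) / 2) =
        (\<Sum>i<n. \<Sum>j<n. (1/2) * (B i j * x i * e j) + (1/2) * (B i j * e i * x j))"
      unfolding quad_form_def sum_subtractf[symmetric] by (intro sum.cong refl) (simp add: field_simps)
    also have "\<dots> = (\<Sum>i<n. \<Sum>j<n. B i j * x i * e j)"
      unfolding sum.distrib sum_distrib_left[symmetric] sw by simp
    finally show ?thesis using 1 by simp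
  qed
  have step: "\<bar>quad_form n B x\<bar> \<le> (t + 33 * s) / 64" if x: "x \<in> S" for x
  proof -
    define k where "k = (\<lambda>i\<in>{..<n}. (if x i \<ge> 0 then \<lfloor>8 * x i\<rfloor> else \<lceil>8 * x i\<rceil>))"
    define e where "e i = (if i < n then 8 * x i - real_of_int (k i) else 0)" for i
    have e1: "\<bar>e i\<bar> \<le> 1" and k8: "\<bar>real_of_int (k i)\<bar> \<le> 8 * \<bar>x i\<bar>" if "i < n" for i
    proof -
      have ei: "e i = 8 * x i - real_of_int (k i)" using that by (simp add: e_def)
      have "\<bar>e i\<bar> \<le> 1 \<and> \<bar>real_of_int (k i)\<bar> \<le> 8 * \<bar>x i\<bar>"
      proof (cases "x i \<ge> 0")
        case True
        then have ki: "k i = \<lfloor>8 * x i\<rfloor>" using that by (simp add: k_def)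
        have "real_of_int (k i) \<le> 8 * x i" "8 * x i \<le> real_of_int (k i) + 1"
          unfolding ki by (rule of_int_floor_le, rule real_of_int_floor_add_one_ge)
        moreover have "0 \<le> real_of_int (k i)" using True by (simp add: ki)
        ultimately show ?thesis using True unfolding ei by linarith
      next
        case False
        then have ki: "k i = \<lceil>8 * x i\<rceil>" using that by (simp add: k_def)
        have "8 * x i \<le> real_of_int (k i)" "real_of_int (k i) \<le> 8 * x i + 1"
          unfolding ki by (rule le_of_int_ceiling, rule of_int_ceiling_le_add_one)
        moreover have "real_of_int (k i) \<le> 0" using False by (simp add: ki)
        ultimately show ?thesis using False unfolding ei by linarith
      qed
      then show "\<bar>e i\<bar> \<le> 1" "\<bar>real_of_int (k i)\<bar> \<le> 8 * \<bar>x i\<bar>" by auto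
    qed
    have e: "e \<in> S"
    proof -
      have "(\<Sum>i<n. (e i)\<^sup>2) \<le> (\<Sum>i<n. 1)"
        using e1 by (intro sum_mono) (auto simp: abs_square_le_1)
      then show ?thesis by (simp add: S_def)
    qed
    have "(\<Sum>i<n. (real_of_int (k i))\<^sup>2) \<le> (\<Sum>i<n. 64 * (x i)\<^sup>2)"
    proof (intro sum_mono)
      fix i assume "i \<in> {..<n}"
      then have "\<bar>real_of_int (k i)\<bar> \<le> \<bar>8 * x i\<bar>" using k8[of i] by simp
      then show "(real_of_int (k i))\<^sup>2 \<le> 64 * (x i)\<^sup>2"
        by (simp add: abs_le_square_iff power_mult_distrib)
    qed
    also have "\<dots> \<le> 64 * real n" using x by (simp add: S_def flip: sum_distrib_left)
    finally have "k \<in> lattice_ball n (64 * real n)" by (simp add: lattice_ball_def k_def)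
    then have "\<bar>quad_form n B (\<lambda>i. real_of_int (k i))\<bar> \<le> t" by (rule net)
    also have "quad_form n B (\<lambda>i. real_of_int (k i)) = quad_form n B (\<lambda>i. 8 * x i - e i)"
      unfolding quad_form_def by (intro sum.cong refl) (simp add: e_def)
    finally have "\<bar>quad_form n B (\<lambda>i. 8 * x i - e i)\<bar> \<le> t" .
    then show ?thesis
      using split[of x e] le_s[OF e] le_s[OF half(1)[OF x e]] le_s[OF half(2)[OF x e]] by argo
  qed
  have "(\<lambda>_. 0) \<in> S" by (simp add: S_def)
  then have "(SUP x\<in>S. \<bar>quad_form n B x\<bar>) \<le> (t + 33 * s) / 64"
    by (intro cSUP_least step) auto
  then have "s \<le> (t + 33 * s) / 64" unfolding s_def[symmetric] .
  then have s: "s \<le> t / 31" by simp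
  define q where "q = (\<Sum>i<n. (x i)\<^sup>2)"
  show ?thesis
  proof (cases "q = 0")
    case True
    then have "x i = 0" if "i < n" for i using that by (simp add: q_def sum_nonneg_eq_0_iff)
    then have "quad_form n B x = 0" by (simp add: quad_form_def)
    then show ?thesis using True by (simp add: q_def)
  next
    case False
    then have q: "q > 0" by (simp add: q_def order_less_le sum_nonneg)
    define l where "l = sqrt (n / q)"
    have l2: "l * l = n / q" using q by (simp add: l_def)
    have "(\<Sum>i<n. (l * x i)\<^sup>2) = l * l * q"
      by (simp add: q_def power_mult_distrib sum_distrib_left power2_eq_square mult_ac)
    then have "(\<lambda>i. l * x i) \<in> S" using q by (simp add: S_def l2)
    then have "\<bar>quad_form n B (\<lambda>i. l * x i)\<bar> \<le> t / 31" using le_s s by (meson order.trans)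
    also have "quad_form n B (\<lambda>i. l * x i) = l * l * quad_form n B x"
      unfolding quad_form_def sum_distrib_left by (intro sum.cong refl) simp
    finally have "n / q * \<bar>quad_form n B x\<bar> \<le> t / 31" using q by (simp add: l2 abs_mult)
    then show ?thesis using n q by (simp add: q_def[symmetric] field_simps)
  qed
qed

section \<open>Measurability of the exceptional event\<close>

text \<open>Projections along a compact factor are closed maps.\<close>

lemma closed_projection_compact:
  fixes T :: "('a::topological_space \<times> 'b::topological_space) set"
  assumes K: "compact K" and T: "closed T"
  shows "closed {c. \<exists>y\<in>K. (y, c) \<in> T}"
proof -
  have "compact_space (top_of_set K)" using K by (simp add: compact_space_subtopology)
  then have "closed_map (prod_topology (top_of_set K) euclidean) (euclidean :: 'b topology) snd"
    by (rule Abstract_Topological_Spaces.closed_map_snd)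
  moreover have "closedin (prod_topology (top_of_set K) (euclidean :: 'b topology)) (T \<inter> K \<times> UNIV)"
  proof -
    have "prod_topology (top_of_set K) (euclidean :: 'b topology) = top_of_set (K \<times> UNIV)"
      using prod_topology_subtopology_eu[of K "UNIV :: 'b set"] by simp
    then show ?thesis using closedin_closed_Int[OF T, of "K \<times> UNIV"] by (simp add: Int_commute)
  qed
  ultimately have "closedin euclidean (snd ` (T \<inter> K \<times> (UNIV :: 'b set)))"
    unfolding closed_map_def by blast
  also have "snd ` (T \<inter> K \<times> UNIV) = {c. \<exists>y\<in>K. (y, c) \<in> T}" by force
  finally show ?thesis by simp
qed

text \<open>The type \<open>real mat\<close> contains matrices of all dimensions and carries no topology, so continuity of
a matrix-valued function means fixed dimensions and continuous entries.\<close>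

definition continuous_mat :: "nat \<Rightarrow> nat \<Rightarrow> ('a::topological_space \<Rightarrow> real mat) \<Rightarrow> bool" where
  "continuous_mat m k F \<longleftrightarrow> (\<forall>x. F x \<in> carrier_mat m k) \<and>
    (\<forall>i<m. \<forall>j<k. continuous_on UNIV (\<lambda>x. F x $$ (i, j)))"

lemma continuous_matI:
  assumes "\<And>x. F x \<in> carrier_mat m k"
    and "\<And>i j. i < m \<Longrightarrow> j < k \<Longrightarrow> continuous_on UNIV (\<lambda>x. F x $$ (i, j))"
  shows "continuous_mat m k F"
  using assms by (simp add: continuous_mat_def)

lemma continuous_mat_carrier: "continuous_mat m k F \<Longrightarrow> F x \<in> carrier_mat m k"
  by (simp add: continuous_mat_def)

lemma continuous_mat_index:
  "continuous_mat m k F \<Longrightarrow> i < m \<Longrightarrow> j < k \<Longrightarrow> continuous_on UNIV (\<lambda>x. F x $$ (i, j))"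
  by (simp add: continuous_mat_def)

lemma continuous_mat_const: "A \<in> carrier_mat m k \<Longrightarrow> continuous_mat m k (\<lambda>_. A)"
  by (simp add: continuous_mat_def)

lemma continuous_mat_mult:
  assumes F: "continuous_mat m k F" and G: "continuous_mat k l G"
  shows "continuous_mat m l (\<lambda>x. F x * G x)"
proof (rule continuous_matI)
  note FG = continuous_mat_carrier[OF F] continuous_mat_carrier[OF G]
  show "F x * G x \<in> carrier_mat m l" for x using FG by (rule mult_carrier_mat)
  fix i j assume ij: "i < m" "j < l"
  show "continuous_on UNIV (\<lambda>x. (F x * G x) $$ (i, j))"
    unfolding mult_index[OF FG ij] using ij
    by (intro continuous_intros continuous_mat_index[OF F] continuous_mat_index[OF G]) auto
qed

lemma continuous_mat_minus:
  assumes F: "continuous_mat m k F" and G: "continuous_mat m k G"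
  shows "continuous_mat m k (\<lambda>x. F x - G x)"
proof (rule continuous_matI)
  note FG = continuous_mat_carrier[OF F] continuous_mat_carrier[OF G]
  show "F x - G x \<in> carrier_mat m k" for x using FG by (simp add: minus_carrier_mat)
  fix i j assume ij: "i < m" "j < k"
  have "(F x - G x) $$ (i, j) = F x $$ (i, j) - G x $$ (i, j)" for x
    using FG[of x] ij by auto
  then show "continuous_on UNIV (\<lambda>x. (F x - G x) $$ (i, j))"
    by (simp only:) (intro continuous_intros continuous_mat_index[OF F] continuous_mat_index[OF G] ij)
qed

lemma continuous_mat_transpose:
  assumes F: "continuous_mat m k F"
  shows "continuous_mat k m (\<lambda>x. transpose_mat (F x))"
proof (rule continuous_matI)
  note Fc = continuous_mat_carrier[OF F]
  show "transpose_mat (F x) \<in> carrier_mat k m" for x using Fc by simp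
  fix i j assume ij: "i < k" "j < m"
  have "transpose_mat (F x) $$ (i, j) = F x $$ (j, i)" for x using Fc[of x] ij by auto
  then show "continuous_on UNIV (\<lambda>x. transpose_mat (F x) $$ (i, j))"
    by (simp only:) (intro continuous_mat_index[OF F] ij)
qed

lemma continuous_mat_ddiag:
  assumes F: "continuous_mat m k F"
  shows "continuous_mat m k (\<lambda>x. ddiag (F x))"
proof (rule continuous_matI)
  note Fc = continuous_mat_carrier[OF F]
  show "ddiag (F x) \<in> carrier_mat m k" for x using Fc by simp
  fix i j assume ij: "i < m" "j < k"
  show "continuous_on UNIV (\<lambda>x. ddiag (F x) $$ (i, j))"
    unfolding ddiag_index[OF Fc ij] using continuous_mat_index[OF F ij] by (cases "i = j") simp_all
qed

lemma continuous_frob_inner: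
  assumes "continuous_mat m k F" "continuous_mat m k G"
  shows "continuous_on UNIV (\<lambda>x. frob_inner (F x) (G x))"
proof -
  have "frob_inner (F x) (G x) = (\<Sum>i<m. \<Sum>j<k. F x $$ (i, j) * G x $$ (i, j))" for x
    using assms by (intro frob_inner_eq_sum) (auto simp: continuous_mat_def)
  then show ?thesis using assms by (auto simp: continuous_mat_def intro!: continuous_intros)
qed

lemma closed_continuous_mat_eq:
  assumes F: "continuous_mat m k F" and A: "A \<in> carrier_mat m k"
  shows "closed {x. F x = A}"
proof -
  have "{x. F x = A} = (\<Inter>i\<in>{..<m}. \<Inter>j\<in>{..<k}. {x. F x $$ (i, j) = A $$ (i, j)})"
    using F A by (auto simp: continuous_mat_def mat_eq_iff)
  also have "closed \<dots>"
    using F by (intro closed_INT ballI closed_Collect_eq) (auto simp: continuous_mat_def)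
  finally show ?thesis .
qed

text \<open>The tangent space varies with \<open>Y\<close>. Writing it as the image of a fixed space under the projection
makes a condition on all tangent vectors an intersection of conditions that depend continuously on \<open>Y\<close>.\<close>

lemma ball_tangent_space_iff:
  assumes feas: "Y \<in> feasible n r"
  shows "(\<forall>V\<in>tangent_space n r Y. P V) \<longleftrightarrow> (\<forall>Z\<in>carrier_mat n r. P (tangent_proj Y Z))"
proof -
  have Y: "Y \<in> carrier_mat n r" using feas by (simp add: feasible_def)
  have "tangent_proj Y V = V" if V: "V \<in> tangent_space n r Y" for V
  proof -
    have Vc: "V \<in> carrier_mat n r" and orth: "\<And>i. i < n \<Longrightarrow> (\<Sum>k<r. V $$ (i, k) * Y $$ (i, k)) = 0"
      using V by (auto simp: tangent_space_iff[OF Y] mult.commute)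
    show ?thesis
      using tangent_proj_carrier[OF Y Vc] Vc
      by (intro eq_matI) (auto simp: tangent_proj_index[OF Y Vc] orth)
  qed
  note fixed = this
  show ?thesis
  proof (intro iffI ballI)
    fix Z :: "real mat" assume "\<forall>V\<in>tangent_space n r Y. P V" "Z \<in> carrier_mat n r"
    then show "P (tangent_proj Y Z)" using tangent_proj_in_tangent_space[OF feas] by blast
  next
    fix V :: "real mat" assume P: "\<forall>Z\<in>carrier_mat n r. P (tangent_proj Y Z)" and V: "V \<in> tangent_space n r Y"
    then have "P (tangent_proj Y V)" by (simp add: tangent_space_def)
    then show "P V" by (simp only: fixed[OF V])
  qed
qed

text \<open>The existential quantifier ranges over uncountably many \<open>Y\<close>. Criticality is a closed condition
on the pair \<open>(Y, C)\<close>, and \<open>Y\<close> not being aligned is the union over \<open>m\<close> of the closed conditions that its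
deviation from alignment be at least \<open>1 / (m + 1)\<close>. The entries of a feasible \<open>Y\<close> lie in \<open>[-1, 1]\<close>, so
eliminating \<open>Y\<close> is a projection along a compact factor. The exceptional matrices \<open>C\<close> therefore form a
countable union of closed sets.\<close>

lemma sets_critical_not_aligned:
  assumes C: "\<And>\<omega>. \<omega> \<in> space M \<Longrightarrow> C \<omega> \<in> carrier_mat n n"
    and sym: "\<And>\<omega>. \<omega> \<in> space M \<Longrightarrow> transpose_mat (C \<omega>) = C \<omega>"
    and meas: "\<And>i j. i < n \<Longrightarrow> j < n \<Longrightarrow> (\<lambda>\<omega>. C \<omega> $$ (i, j)) \<in> borel_measurable M"
  shows "{\<omega> \<in> space M. \<exists>Y. second_order_critical n r (objective (C \<omega>)) Y \<and> \<not> aligned n r z Y} \<in> sets M"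
proof -
  define Cm :: "(nat \<times> nat \<Rightarrow> real) \<Rightarrow> real mat" where "Cm c = mat n n c" for c
  define Ym :: "(nat \<times> nat \<Rightarrow> real) \<Rightarrow> real mat" where "Ym y = mat n r y" for y
  define K :: "(nat \<times> nat \<Rightarrow> real) set" where "K = (\<Pi>\<^sub>E p\<in>UNIV. {-1..1})"
  define dev where "dev y i j k = z $ i * Ym y $$ (i, k) - z $ j * Ym y $$ (j, k)" for y i j k
  define gap where "gap y = (\<Sum>i<n. \<Sum>j<n. \<Sum>k<r. (dev y i j k)\<^sup>2)" for y
  define crit where "crit = {(y, c). Ym y \<in> feasible n r \<and> slack_mat (Cm c) (Ym y) * Ym y = 0\<^sub>m n r \<and>
    (\<forall>Z\<in>carrier_mat n r. 0 \<le> frob_inner (slack_mat (Cm c) (Ym y))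
      (tangent_proj (Ym y) Z * transpose_mat (tangent_proj (Ym y) Z)))}"
  define bad where "bad m = crit \<inter> {(y, c). inverse (real (Suc m)) \<le> gap y}" for m
  have K: "compact K"
    using compactin_PiE[of "\<lambda>_. euclidean" UNIV "\<lambda>_::nat \<times> nat. {-1..1::real}"]
    by (simp add: K_def euclidean_product_topology compactin_euclidean_iff)
  have cY: "continuous_mat n r (\<lambda>x::(nat \<times> nat \<Rightarrow> real) \<times> (nat \<times> nat \<Rightarrow> real). Ym (fst x))"
  proof (rule continuous_matI)
    fix i j assume ij: "i < n" "j < r"
    have "continuous_on UNIV (\<lambda>x::(nat \<times> nat \<Rightarrow> real) \<times> (nat \<times> nat \<Rightarrow> real). fst x (i, j))"
      by (rule continuous_on_product_then_coordinatewise[OF continuous_on_fst[OF continuous_on_id]])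
    then show "continuous_on UNIV (\<lambda>x::(nat \<times> nat \<Rightarrow> real) \<times> (nat \<times> nat \<Rightarrow> real). Ym (fst x) $$ (i, j))"
      using ij by (simp add: Ym_def)
  qed (simp add: Ym_def)
  have cC: "continuous_mat n n (\<lambda>x::(nat \<times> nat \<Rightarrow> real) \<times> (nat \<times> nat \<Rightarrow> real). Cm (snd x))"
  proof (rule continuous_matI)
    fix i j assume ij: "i < n" "j < n"
    have "continuous_on UNIV (\<lambda>x::(nat \<times> nat \<Rightarrow> real) \<times> (nat \<times> nat \<Rightarrow> real). snd x (i, j))"
      by (rule continuous_on_product_then_coordinatewise[OF continuous_on_snd[OF continuous_on_id]])
    then show "continuous_on UNIV (\<lambda>x::(nat \<times> nat \<Rightarrow> real) \<times> (nat \<times> nat \<Rightarrow> real). Cm (snd x) $$ (i, j))"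
      using ij by (simp add: Cm_def)
  qed (simp add: Cm_def)
  note cYT = continuous_mat_transpose[OF cY]
  have cS: "continuous_mat n n (\<lambda>x. slack_mat (Cm (snd x)) (Ym (fst x)))"
    unfolding slack_mat_def
    by (rule continuous_mat_minus[OF continuous_mat_ddiag[OF
      continuous_mat_mult[OF continuous_mat_mult[OF cC cY] cYT]] cC])
  have cP: "continuous_mat n r (\<lambda>x::_ \<times> (nat \<times> nat \<Rightarrow> real). tangent_proj (Ym (fst x)) Z)" if "Z \<in> carrier_mat n r" for Z
    unfolding tangent_proj_def
    by (rule continuous_mat_minus[OF continuous_mat_const[OF that] continuous_mat_mult[OF
      continuous_mat_ddiag[OF continuous_mat_mult[OF continuous_mat_const[OF that] cYT]] cY]])
  have "closed crit"
  proof -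
    have "crit = {x. ddiag (Ym (fst x) * transpose_mat (Ym (fst x))) = 1\<^sub>m n} \<inter>
        {x. slack_mat (Cm (snd x)) (Ym (fst x)) * Ym (fst x) = 0\<^sub>m n r} \<inter>
        (\<Inter>Z\<in>carrier_mat n r. {x. 0 \<le> frob_inner (slack_mat (Cm (snd x)) (Ym (fst x)))
          (tangent_proj (Ym (fst x)) Z * transpose_mat (tangent_proj (Ym (fst x)) Z))})"
      by (auto simp: crit_def feasible_def Ym_def)
    also have "closed \<dots>"
    proof (intro closed_Int closed_INT ballI)
      show "closed {x :: _ \<times> (nat \<times> nat \<Rightarrow> real). ddiag (Ym (fst x) * transpose_mat (Ym (fst x))) = 1\<^sub>m n}"
        by (rule closed_continuous_mat_eq[OF continuous_mat_ddiag[OF continuous_mat_mult[OF cY cYT]]]) simp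
      show "closed {x. slack_mat (Cm (snd x)) (Ym (fst x)) * Ym (fst x) = 0\<^sub>m n r}"
        by (rule closed_continuous_mat_eq[OF continuous_mat_mult[OF cS cY]]) simp
      fix Z :: "real mat" assume "Z \<in> carrier_mat n r"
      note P = cP[OF this]
      show "closed {x. 0 \<le> frob_inner (slack_mat (Cm (snd x)) (Ym (fst x)))
          (tangent_proj (Ym (fst x)) Z * transpose_mat (tangent_proj (Ym (fst x)) Z))}"
        by (intro closed_Collect_le continuous_intros
          continuous_frob_inner[OF cS continuous_mat_mult[OF P continuous_mat_transpose[OF P]]])
    qed
    finally show ?thesis .
  qed
  moreover have "closed {x :: _ \<times> (nat \<times> nat \<Rightarrow> real). inverse (real (Suc m)) \<le> gap (fst x)}" for m
    unfolding gap_def dev_def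
    by (intro closed_Collect_le continuous_intros continuous_mat_index[OF cY]) auto
  ultimately have "closed (bad m)" for m
    unfolding bad_def by (intro closed_Int) (simp_all add: case_prod_unfold)
  then have closed_bad: "closed {c. \<exists>y\<in>K. (y, c) \<in> bad m}" for m
    by (intro closed_projection_compact K)
  define ent where "ent \<omega> p = (if fst p < n \<and> snd p < n then C \<omega> $$ p else 0)" for \<omega> p
  have Cent: "Cm (ent \<omega>) = C \<omega>" if "\<omega> \<in> space M" for \<omega>
    using C[OF that] by (intro eq_matI) (auto simp: Cm_def ent_def)
  have crit_iff: "(y, ent \<omega>) \<in> crit \<longleftrightarrow> second_order_critical n r (objective (C \<omega>)) (Ym y)"
    if "\<omega> \<in> space M" for \<omega> y
    unfolding second_order_critical_objective_iff[OF C[OF that] sym[OF that]]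
  proof (cases "Ym y \<in> feasible n r")
    case True
    then show "(y, ent \<omega>) \<in> crit \<longleftrightarrow> Ym y \<in> feasible n r \<and>
        slack_mat (C \<omega>) (Ym y) * Ym y = 0\<^sub>m n r \<and>
        (\<forall>V\<in>tangent_space n r (Ym y). 0 \<le> frob_inner (slack_mat (C \<omega>) (Ym y)) (V * transpose_mat V))"
      unfolding ball_tangent_space_iff[OF True] crit_def by (simp only: case_prod_conv mem_Collect_eq Cent[OF that])
  qed (simp add: crit_def)
  have gap_iff: "gap y > 0 \<longleftrightarrow> \<not> aligned n r z (Ym y)" for y
  proof -
    have "gap y = 0 \<longleftrightarrow> (\<forall>i<n. \<forall>j<n. \<forall>k<r. dev y i j k = 0)"
      unfolding gap_def by (simp add: sum_nonneg sum_nonneg_eq_0_iff) blast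
    also have "\<dots> \<longleftrightarrow> aligned n r z (Ym y)"
      by (simp only: aligned_def dev_def right_minus_eq)
    finally have "gap y = 0 \<longleftrightarrow> aligned n r z (Ym y)" .
    moreover have "gap y \<ge> 0" unfolding gap_def by (intro sum_nonneg) auto
    ultimately show ?thesis by linarith
  qed
  have ent: "ent \<in> borel_measurable M"
  proof (rule measurable_coordinatewise_then_product)
    show "(\<lambda>\<omega>. ent \<omega> p) \<in> borel_measurable M" for p
    proof (cases "fst p < n \<and> snd p < n")
      case True
      then show ?thesis using meas[of "fst p" "snd p"] by (simp add: ent_def)
    next
      case False
      then have "(\<lambda>\<omega>. ent \<omega> p) = (\<lambda>\<omega>. 0)" by (auto simp: ent_def)
      then show ?thesis by simp
    qed
  qed
  have "ent -` {c. \<exists>y\<in>K. (y, c) \<in> bad m} \<inter> space M \<in> sets M" for m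
    by (rule measurable_sets[OF ent borel_closed[OF closed_bad]])
  then have "(\<Union>m. ent -` {c. \<exists>y\<in>K. (y, c) \<in> bad m} \<inter> space M) \<in> sets M"
    by (intro sets.countable_UN) blast
  also have "(\<Union>m. ent -` {c. \<exists>y\<in>K. (y, c) \<in> bad m} \<inter> space M) =
    {\<omega> \<in> space M. \<exists>Y. second_order_critical n r (objective (C \<omega>)) Y \<and> \<not> aligned n r z Y}"
  proof (intro equalityI subsetI)
    fix \<omega>
    {
      assume "\<omega> \<in> (\<Union>m. ent -` {c. \<exists>y\<in>K. (y, c) \<in> bad m} \<inter> space M)"
      then obtain m y where \<omega>: "\<omega> \<in> space M" and "(y, ent \<omega>) \<in> bad m" by auto
      then have "(y, ent \<omega>) \<in> crit" and "inverse (real (Suc m)) \<le> gap y" by (auto simp: bad_def)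
      then have "second_order_critical n r (objective (C \<omega>)) (Ym y)" and "gap y > 0"
        using crit_iff[OF \<omega>] by (auto intro: less_le_trans[of 0 "inverse (real (Suc m))"])
      then show "\<omega> \<in> {\<omega> \<in> space M. \<exists>Y. second_order_critical n r (objective (C \<omega>)) Y \<and> \<not> aligned n r z Y}"
        using \<omega> gap_iff by auto
    }
    assume "\<omega> \<in> {\<omega> \<in> space M. \<exists>Y. second_order_critical n r (objective (C \<omega>)) Y \<and> \<not> aligned n r z Y}"
    then obtain Y where \<omega>: "\<omega> \<in> space M" and Y: "second_order_critical n r (objective (C \<omega>)) Y"
      "\<not> aligned n r z Y" by auto
    have feas: "Y \<in> feasible n r" using Y by (simp add: second_order_critical_def)
    then have Yc: "Y \<in> carrier_mat n r" by (simp add: feasible_def)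
    define y where "y p = (if fst p < n \<and> snd p < r then Y $$ p else 0)" for p
    have Yy: "Ym y = Y" using Yc by (intro eq_matI) (auto simp: Ym_def y_def)
    have "\<bar>Y $$ (i, k)\<bar> \<le> 1" if "i < n" "k < r" for i k
    proof -
      have "(Y $$ (i, k))\<^sup>2 \<le> (\<Sum>k<r. (Y $$ (i, k))\<^sup>2)" using that by (intro member_le_sum) auto
      then show ?thesis using feas that by (simp add: feasible_iff abs_square_le_1)
    qed
    then have "\<bar>y p\<bar> \<le> 1" for p by (cases p) (simp add: y_def)
    then have "y p \<in> {-1..1}" for p by (metis abs_le_D1 abs_le_D2 atLeastAtMost_iff minus_le_iff)
    then have "y \<in> K" by (auto simp: K_def)
    moreover obtain m where "inverse (real (Suc m)) < gap y"
      using gap_iff[of y] Y(2) reals_Archimedean[of "gap y"] by (auto simp: Yy)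
    then have "(y, ent \<omega>) \<in> bad m" using Y(1) crit_iff[OF \<omega>, of y] by (simp add: bad_def Yy)
    ultimately show "\<omega> \<in> (\<Union>m. ent -` {c. \<exists>y\<in>K. (y, c) \<in> bad m} \<inter> space M)" using \<omega> by auto
  qed
  finally show ?thesis .
qed

section \<open>Row sums and operator norm of a Gaussian matrix\<close>

lemma sum_off_diagonal_pairs:
  fixes h :: "nat \<Rightarrow> nat \<Rightarrow> real"
  assumes "\<And>i. i < n \<Longrightarrow> h i i = 0"
  shows "(\<Sum>i<n. \<Sum>j<n. h i j) = (\<Sum>(i, j)\<in>{(i, j). i < j \<and> j < n}. h i j + h j i)"
proof -
  define P where "P = {(i, j). i < j \<and> j < n}"
  have fin: "finite P" unfolding P_def
    by (rule finite_subset[of _ "{..<n} \<times> {..<n}"]) auto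
  have "(\<Sum>i<n. \<Sum>j<n. h i j) = (\<Sum>(i, j)\<in>{..<n} \<times> {..<n}. h i j)"
    by (simp add: sum.cartesian_product)
  also have "\<dots> = (\<Sum>(i, j)\<in>P \<union> prod.swap ` P. h i j)"
  proof (intro sum.mono_neutral_right ballI)
    fix p assume p: "p \<in> {..<n} \<times> {..<n} - (P \<union> prod.swap ` P)"
    then obtain a b where ab: "p = (a, b)" "a < n" "b < n" by auto
    then have "(a, b) \<notin> P" "(b, a) \<notin> P" using p by force+
    then have "a = b" using ab by (auto simp: P_def)
    then show "(case p of (i, j) \<Rightarrow> h i j) = 0" using ab assms by simp
  qed (auto simp: P_def)
  also have "\<dots> = (\<Sum>(i, j)\<in>P. h i j) + (\<Sum>(i, j)\<in>prod.swap ` P. h i j)"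
    using fin by (intro sum.union_disjoint) (auto simp: P_def)
  also have "(\<Sum>(i, j)\<in>prod.swap ` P. h i j) = (\<Sum>(i, j)\<in>P. h j i)"
    by (subst sum.reindex) (auto simp: inj_on_def case_prod_unfold)
  finally show ?thesis by (simp add: P_def sum.distrib case_prod_unfold)
qed

text \<open>The diagonal of the noise is an arbitrary measurable function, so it must not enter
the concentration estimates.\<close>

definition off_diag :: "real mat \<Rightarrow> nat \<Rightarrow> nat \<Rightarrow> real" where
  "off_diag A i j = (if i = j then 0 else A $$ (i, j))"

lemma off_diag_sym:
  assumes "A \<in> carrier_mat n n" "transpose_mat A = A" "i < n" "j < n"
  shows "off_diag A i j = off_diag A j i"
  using assms by (metis carrier_matD index_transpose_mat(1) off_diag_def)

lemma row_as_linear_form: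
  assumes A: "A \<in> carrier_mat n n" "transpose_mat A = A" and i: "i < n"
  shows "(\<Sum>j<n. off_diag A i j * s j) = (\<Sum>p\<in>{(i, j). i < j \<and> j < n}.
    ((if fst p = i then s (snd p) else 0) + (if snd p = i then s (fst p) else 0)) * A $$ p)"
proof -
  have "(\<Sum>j<n. off_diag A i j * s j) = (\<Sum>a<n. \<Sum>b<n. if a = i then off_diag A a b * s b else 0)"
    using i by (subst sum.swap) simp
  also have "\<dots> = (\<Sum>(a, b)\<in>{(i, j). i < j \<and> j < n}.
      (if a = i then off_diag A a b * s b else 0) + (if b = i then off_diag A b a * s a else 0))"
    by (rule sum_off_diagonal_pairs) (simp add: off_diag_def)
  also have "\<dots> = (\<Sum>p\<in>{(i, j). i < j \<and> j < n}.
    ((if fst p = i then s (snd p) else 0) + (if snd p = i then s (fst p) else 0)) * A $$ p)"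
  proof (intro sum.cong refl)
    fix p assume "p \<in> {(i, j). i < j \<and> j < n}"
    then obtain a b where p: "p = (a, b)" "a < b" "b < n" by auto
    have "off_diag A b a = A $$ (a, b)" "off_diag A a b = A $$ (a, b)"
      using off_diag_sym[OF A, of b a] p by (auto simp: off_diag_def)
    then show "(case p of (a, b) \<Rightarrow>
        (if a = i then off_diag A a b * s b else 0) + (if b = i then off_diag A b a * s a else 0)) =
      ((if fst p = i then s (snd p) else 0) + (if snd p = i then s (fst p) else 0)) * A $$ p"
      using p by auto
  qed
  finally show ?thesis .
qed

lemma row_coefficients_sum_sq:
  assumes i: "i < n" and s: "\<And>j. j < n \<Longrightarrow> (s j)\<^sup>2 = (1 :: real)"
  shows "(\<Sum>p\<in>{(i, j). i < j \<and> j < n}.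
    ((if fst p = i then s (snd p) else 0) + (if snd p = i then s (fst p) else 0))\<^sup>2) \<le> real n"
proof -
  have "(\<Sum>p\<in>{(i, j). i < j \<and> j < n}.
      ((if fst p = i then s (snd p) else 0) + (if snd p = i then s (fst p) else 0))\<^sup>2) =
    (\<Sum>(a, b)\<in>{(i, j). i < j \<and> j < n}.
      (if a = i \<and> a \<noteq> b then 1 else 0) + (if b = i \<and> b \<noteq> a then 1 else 0))"
    by (intro sum.cong refl) (auto simp: s)
  also have "\<dots> = (\<Sum>a<n. \<Sum>b<n. if a = i \<and> a \<noteq> b then 1 else 0)"
    by (rule sum_off_diagonal_pairs[symmetric]) simp
  also have "\<dots> \<le> (\<Sum>a<n. \<Sum>b<n. if a = i then 1 else 0)"
    by (intro sum_mono) auto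
  also have "\<dots> = real n" using i by (subst sum.swap) simp
  finally show ?thesis .
qed

lemma quad_form_as_linear_form:
  assumes A: "A \<in> carrier_mat n n" "transpose_mat A = A"
  shows "quad_form n (off_diag A) x =
    (\<Sum>p\<in>{(i, j). i < j \<and> j < n}. (2 * x (fst p) * x (snd p)) * A $$ p)"
  unfolding quad_form_def
proof (subst sum_off_diagonal_pairs)
  show "(\<Sum>(i, j)\<in>{(i, j). i < j \<and> j < n}. off_diag A i j * x i * x j + off_diag A j i * x j * x i) =
    (\<Sum>p\<in>{(i, j). i < j \<and> j < n}. (2 * x (fst p) * x (snd p)) * A $$ p)"
  proof (intro sum.cong refl)
    fix p assume "p \<in> {(i, j). i < j \<and> j < n}"
    then obtain a b where p: "p = (a, b)" "a < b" "b < n" by auto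
    have "off_diag A b a = A $$ (a, b)" "off_diag A a b = A $$ (a, b)"
      using off_diag_sym[OF A, of b a] p by (auto simp: off_diag_def)
    then show "(case p of (i, j) \<Rightarrow> off_diag A i j * x i * x j + off_diag A j i * x j * x i) =
      (2 * x (fst p) * x (snd p)) * A $$ p"
      using p by simp
  qed
qed (simp add: off_diag_def)

lemma quad_form_coefficients_sum_sq:
  fixes x :: "nat \<Rightarrow> real"
  shows "(\<Sum>p\<in>{(i, j). i < j \<and> j < n}. (2 * x (fst p) * x (snd p))\<^sup>2) \<le> 2 * (\<Sum>i<n. (x i)\<^sup>2)\<^sup>2"
proof -
  define h where "h a b = (if a = b then 0 else 2 * ((x a)\<^sup>2 * (x b)\<^sup>2))" for a b
  have "(\<Sum>p\<in>{(i, j). i < j \<and> j < n}. (2 * x (fst p) * x (snd p))\<^sup>2) =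
    (\<Sum>(a, b)\<in>{(i, j). i < j \<and> j < n}. h a b + h b a)"
    by (intro sum.cong refl) (auto simp: h_def power_mult_distrib)
  also have "\<dots> = (\<Sum>a<n. \<Sum>b<n. h a b)"
    by (rule sum_off_diagonal_pairs[symmetric]) (simp add: h_def)
  also have "\<dots> \<le> (\<Sum>a<n. \<Sum>b<n. 2 * ((x a)\<^sup>2 * (x b)\<^sup>2))"
    by (intro sum_mono) (auto simp: h_def)
  also have "\<dots> = 2 * (\<Sum>i<n. (x i)\<^sup>2)\<^sup>2"
    by (simp only: power2_eq_square[of "\<Sum>i<n. (x i)\<^sup>2"] sum_product) (simp only: sum_distrib_left)
  finally show ?thesis .
qed

text \<open>A union bound over \<open>n\<close> signed row sums, of variance at most \<open>n\<close>, and over the quadratic forms at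
the lattice points of \<open>lattice_ball n (64 n)\<close>, of variance at most \<open>2 (64 n)\<^sup>2\<close>. There are at most
\<open>exp (66 n)\<close> lattice points, and the threshold \<open>t = 1240 n\<close> times \<open>\<surd>n\<close> for the latter makes each tail at
most \<open>2 exp (- 93 n)\<close>, since \<open>1240\<^sup>2 / (4 \<cdot> 64\<^sup>2) > 93\<close>. The operator norm bound is then
\<open>t / (31 n) = 40\<close> times \<open>\<surd>n\<close>.\<close>

lemma (in prob_space) gaussian_matrix_bounds:
  fixes W :: "'a \<Rightarrow> real mat" and s :: "nat \<Rightarrow> real"
  assumes n: "n > 0" and D: "D > 0"
    and dim: "\<And>\<omega>. \<omega> \<in> space M \<Longrightarrow> W \<omega> \<in> carrier_mat n n"
    and sym: "\<And>\<omega>. \<omega> \<in> space M \<Longrightarrow> transpose_mat (W \<omega>) = W \<omega>"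
    and normal: "\<And>i j. i < j \<Longrightarrow> j < n \<Longrightarrow> distributed M lborel (\<lambda>\<omega>. W \<omega> $$ (i, j)) std_normal_density"
    and indep: "indep_vars (\<lambda>_. borel) (\<lambda>p \<omega>. W \<omega> $$ p) {(i, j). i < j \<and> j < n}"
    and s: "\<And>j. j < n \<Longrightarrow> (s j)\<^sup>2 = 1"
  obtains E where "E \<in> events"
    and "prob E \<ge> 1 - (2 * real n * exp (- (D\<^sup>2 / (2 * real n))) + 2 * exp (- real n))"
    and "\<And>\<omega> i. \<omega> \<in> E \<Longrightarrow> i < n \<Longrightarrow> \<bar>\<Sum>j<n. off_diag (W \<omega>) i j * s j\<bar> \<le> D"
    and "\<And>\<omega> v. \<omega> \<in> E \<Longrightarrow> \<bar>quad_form n (off_diag (W \<omega>)) v\<bar> \<le> 40 * sqrt n * (\<Sum>i<n. (v i)\<^sup>2)"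
proof -
  define P where "P = {(i, j). i < j \<and> j < n}"
  define lin where "lin c \<omega> = (\<Sum>p\<in>P. c p * W \<omega> $$ p)" for c \<omega>
  define row where "row i p = (if fst p = i then s (snd p) else 0) + (if snd p = i then s (fst p) else 0)"
    for i and p :: "nat \<times> nat"
  define quad where "quad k p = 2 * real_of_int (k (fst p)) * real_of_int (k (snd p))"
    for k :: "nat \<Rightarrow> int" and p :: "nat \<times> nat"
  define t where "t = 1240 * real n * sqrt n"
  define L where "L = lattice_ball n (64 * real n)"
  define bad where "bad a c = {\<omega> \<in> space M. \<bar>lin c \<omega>\<bar> \<ge> a}" for a c
  have finP: "finite P" unfolding P_def
    by (rule finite_subset[of _ "{..<n} \<times> {..<n}"]) auto
  have normalP: "distributed M lborel (\<lambda>\<omega>. W \<omega> $$ p) std_normal_density" if "p \<in> P" for p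
    using that normal by (auto simp: P_def)
  have rvP: "(\<lambda>\<omega>. W \<omega> $$ p) \<in> borel_measurable M" if "p \<in> P" for p
    using indep that by (auto simp: indep_vars_def P_def)
  have lin_rv: "lin c \<in> borel_measurable M" for c
    unfolding lin_def[abs_def] by (intro borel_measurable_sum borel_measurable_times rvP) auto
  have bad_ev: "bad a c \<in> events" for a c
    unfolding bad_def using lin_rv[of c] by measurable
  have finL: "finite L" unfolding L_def by (rule finite_lattice_ball) simp
  have t: "t > 0" using n by (simp add: t_def)
  have row_tail: "prob (bad D (row i)) \<le> 2 * exp (- (D\<^sup>2 / (2 * real n)))" if i: "i < n" for i
    unfolding bad_def lin_def
  proof (rule gaussian_linear_form_tail[OF finP _ normalP _ _ D])
    show "(\<Sum>p\<in>P. (row i p)\<^sup>2) \<le> real n"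
      unfolding row_def P_def by (rule row_coefficients_sum_sq[OF i s])
  qed (use indep n in \<open>simp_all add: P_def\<close>)
  have quad_tail: "prob (bad t (quad k)) \<le> 2 * exp (- (93 * real n))" if k: "k \<in> L" for k
  proof -
    have "prob (bad t (quad k)) \<le> 2 * exp (- (t\<^sup>2 / (2 * (2 * (64 * real n)\<^sup>2))))"
      unfolding bad_def lin_def
    proof (rule gaussian_linear_form_tail[OF finP _ normalP _ _ t])
      have "(\<Sum>p\<in>P. (quad k p)\<^sup>2) \<le> 2 * (\<Sum>i<n. (real_of_int (k i))\<^sup>2)\<^sup>2"
        unfolding quad_def P_def by (rule quad_form_coefficients_sum_sq)
      also have "\<dots> \<le> 2 * (64 * real n)\<^sup>2"
        using k by (intro mult_left_mono power_mono) (auto simp: L_def lattice_ball_def sum_nonneg)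
      finally show "(\<Sum>p\<in>P. (quad k p)\<^sup>2) \<le> 2 * (64 * real n)\<^sup>2" .
    qed (use indep n in \<open>simp_all add: P_def\<close>)
    also have "t\<^sup>2 / (2 * (2 * (64 * real n)\<^sup>2)) = 1537600 / 16384 * real n"
      using n by (simp add: t_def power_mult_distrib power2_eq_square)
    also have "2 * exp (- (1537600 / 16384 * real n)) \<le> 2 * exp (- (93 * real n))"
      using n by simp
    finally show ?thesis .
  qed
  have cardL: "real (card L) \<le> exp (66 * real n)"
  proof -
    have "(3::real) \<le> exp 2" using exp_ge_add_one_self[of 2] by simp
    then have "(3::real) ^ n \<le> exp 2 ^ n" by (intro power_mono) auto
    also have "\<dots> = exp (2 * real n)" by (simp add: mult.commute flip: exp_of_nat_mult)
    finally have "exp (64 * real n) * 3 ^ n \<le> exp (64 * real n) * exp (2 * real n)"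
      by (intro mult_left_mono) auto
    then show ?thesis
      using card_lattice_ball_le[of "64 * real n" n] by (simp add: L_def flip: exp_add)
  qed
  define R where "R = (\<Union>i\<in>{..<n}. bad D (row i))"
  define Q where "Q = (\<Union>k\<in>L. bad t (quad k))"
  have R_ev: "R \<in> events" and Q_ev: "Q \<in> events"
    unfolding R_def Q_def using bad_ev finL by (auto intro!: sets.finite_UN)
  have "prob R \<le> (\<Sum>i<n. prob (bad D (row i)))"
    unfolding R_def using bad_ev by (intro finite_measure_subadditive_finite) auto
  also have "\<dots> \<le> (\<Sum>i<n. 2 * exp (- (D\<^sup>2 / (2 * real n))))"
    by (intro sum_mono row_tail) auto
  finally have R: "prob R \<le> 2 * real n * exp (- (D\<^sup>2 / (2 * real n)))" by simp
  have "prob Q \<le> (\<Sum>k\<in>L. prob (bad t (quad k)))"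
    unfolding Q_def using bad_ev finL by (intro finite_measure_subadditive_finite) auto
  also have "\<dots> \<le> (\<Sum>k\<in>L. 2 * exp (- (93 * real n)))"
    by (intro sum_mono quad_tail)
  also have "\<dots> = real (card L) * (2 * exp (- (93 * real n)))" by simp
  also have "\<dots> \<le> exp (66 * real n) * (2 * exp (- (93 * real n)))"
    using cardL by (intro mult_right_mono) auto
  also have "\<dots> = 2 * exp (- (27 * real n))" by (simp flip: exp_add)
  also have "\<dots> \<le> 2 * exp (- real n)" by simp
  finally have Q: "prob Q \<le> 2 * exp (- real n)" .
  show ?thesis
  proof (rule that[of "space M - (R \<union> Q)"])
    show "space M - (R \<union> Q) \<in> events" using R_ev Q_ev by auto
    have "prob (space M - (R \<union> Q)) = 1 - prob (R \<union> Q)"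
      using R_ev Q_ev by (intro prob_compl) auto
    moreover have "prob (R \<union> Q) \<le> prob R + prob Q" using R_ev Q_ev by (rule measure_Un_le)
    ultimately show "prob (space M - (R \<union> Q)) \<ge>
        1 - (2 * real n * exp (- (D\<^sup>2 / (2 * real n))) + 2 * exp (- real n))"
      using R Q by linarith
  next
    fix \<omega> i assume \<omega>: "\<omega> \<in> space M - (R \<union> Q)" and i: "i < n"
    then have "\<omega> \<notin> bad D (row i)" by (auto simp: R_def)
    then have "\<bar>lin (row i) \<omega>\<bar> \<le> D" using \<omega> by (simp add: bad_def)
    then show "\<bar>\<Sum>j<n. off_diag (W \<omega>) i j * s j\<bar> \<le> D"
      using \<omega> by (subst row_as_linear_form[OF dim sym i]) (simp_all add: lin_def row_def P_def)
  next
    fix \<omega> v assume \<omega>: "\<omega> \<in> space M - (R \<union> Q)"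
    then have W: "W \<omega> \<in> carrier_mat n n" "transpose_mat (W \<omega>) = W \<omega>" using dim sym by auto
    have "\<bar>quad_form n (off_diag (W \<omega>)) v\<bar> \<le> t / (31 * real n) * (\<Sum>i<n. (v i)\<^sup>2)"
    proof (rule abs_quad_form_le_of_lattice[OF off_diag_sym[OF W] _ n])
      fix k assume k: "k \<in> lattice_ball n (64 * real n)"
      then have "\<omega> \<notin> bad t (quad k)" using \<omega> by (auto simp: Q_def L_def)
      then have "\<bar>lin (quad k) \<omega>\<bar> \<le> t" using \<omega> by (simp add: bad_def)
      then show "\<bar>quad_form n (off_diag (W \<omega>)) (\<lambda>i. real_of_int (k i))\<bar> \<le> t"
        unfolding quad_form_as_linear_form[OF W] by (simp add: lin_def quad_def P_def)
    qed auto
    also have "t / (31 * real n) = 40 * sqrt n" using n by (simp add: t_def)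
    finally show "\<bar>quad_form n (off_diag (W \<omega>)) v\<bar> \<le> 40 * sqrt n * (\<Sum>i<n. (v i)\<^sup>2)" .
  qed
qed

section \<open>The spiked matrix\<close>

lemma
  assumes z: "z \<in> carrier_vec n" and W: "W \<in> carrier_mat n n"
  shows spiked_mat_carrier: "outer_prod z z + \<sigma> \<cdot>\<^sub>m W \<in> carrier_mat n n"
    and spiked_mat_index: "i < n \<Longrightarrow> j < n \<Longrightarrow>
      (outer_prod z z + \<sigma> \<cdot>\<^sub>m W) $$ (i, j) = z $ i * z $ j + \<sigma> * W $$ (i, j)"
  using assms by (simp_all add: outer_prod_def)

lemma spiked_mat_symmetric:
  assumes z: "z \<in> carrier_vec n" and W: "W \<in> carrier_mat n n" "transpose_mat W = W"
  shows "transpose_mat (outer_prod z z + \<sigma> \<cdot>\<^sub>m W) = outer_prod z z + \<sigma> \<cdot>\<^sub>m W"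
proof (rule eq_matI)
  note C = spiked_mat_carrier[OF z W(1), of \<sigma>]
  fix i j assume "i < dim_row (outer_prod z z + \<sigma> \<cdot>\<^sub>m W)" "j < dim_col (outer_prod z z + \<sigma> \<cdot>\<^sub>m W)"
  then have ij: "i < n" "j < n" using C by auto
  have "W $$ (j, i) = W $$ (i, j)"
    using ij W by (metis carrier_matD index_transpose_mat(1))
  then have "(outer_prod z z + \<sigma> \<cdot>\<^sub>m W) $$ (j, i) = (outer_prod z z + \<sigma> \<cdot>\<^sub>m W) $$ (i, j)"
    unfolding spiked_mat_index[OF z W(1) ij] spiked_mat_index[OF z W(1) ij(2,1)]
    by (simp add: mult.commute)
  moreover have "transpose_mat (outer_prod z z + \<sigma> \<cdot>\<^sub>m W) $$ (i, j) = (outer_prod z z + \<sigma> \<cdot>\<^sub>m W) $$ (j, i)"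
    using C ij by (intro index_transpose_mat(1)) auto
  ultimately show "transpose_mat (outer_prod z z + \<sigma> \<cdot>\<^sub>m W) $$ (i, j) = (outer_prod z z + \<sigma> \<cdot>\<^sub>m W) $$ (i, j)"
    by simp
qed (use W in auto)

lemma spiked_critical_point_aligned:
  assumes z: "z \<in> carrier_vec n" "\<And>i. i < n \<Longrightarrow> z $ i \<in> {1, -1 :: real}"
    and W: "W \<in> carrier_mat n n" "transpose_mat W = W"
    and \<sigma>: "\<sigma> \<ge> 0"
    and soc: "second_order_critical n r (objective (outer_prod z z + \<sigma> \<cdot>\<^sub>m W)) Y"
    and r: "r \<ge> 3"
    and row: "\<And>i. i < n \<Longrightarrow> \<bar>\<Sum>j<n. off_diag W i j * z $ j\<bar> \<le> D"
    and quad: "\<And>v. \<bar>quad_form n (off_diag W) v\<bar> \<le> N * (\<Sum>i<n. (v i)\<^sup>2)"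
    and small: "(real r - 1) * (\<sigma> * D) + (real r + 3) * (\<sigma> * N) \<le> (real r - 3) * real n"
  shows "aligned n r z Y"
proof -
  define C where "C = outer_prod z z + \<sigma> \<cdot>\<^sub>m W"
  have C: "C \<in> carrier_mat n n" unfolding C_def by (rule spiked_mat_carrier[OF z(1) W(1)])
  have Cix: "C $$ (i, j) = z $ i * z $ j + \<sigma> * W $$ (i, j)" if "i < n" "j < n" for i j
    unfolding C_def by (rule spiked_mat_index[OF z(1) W(1) that])
  have sym: "transpose_mat C = C" unfolding C_def by (rule spiked_mat_symmetric[OF z(1) W])
  have sq: "z $ i * z $ i = 1" if "i < n" for i using z(2)[OF that] by auto
  have A: "(if i = j then 0 else z $ i * z $ j * C $$ (i, j) - 1) = \<sigma> * (z $ i * (off_diag W i j * z $ j))"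
    if "i < n" "j < n" for i j
  proof -
    have "z $ i * z $ j * (z $ i * z $ j) = (z $ i * z $ i) * (z $ j * z $ j)" by (simp only: mult_ac)
    then have "z $ i * z $ j * (z $ i * z $ j) = 1" using that by (simp add: sq)
    then show ?thesis using that by (simp add: Cix off_diag_def distrib_left mult_ac)
  qed
  show ?thesis
  proof (rule second_order_critical_aligned[OF C sym z(2) _ r])
    show "second_order_critical n r (objective C) Y" using soc by (simp add: C_def)
    show "\<bar>\<Sum>j<n. if i = j then 0 else z $ i * z $ j * C $$ (i, j) - 1\<bar> \<le> \<sigma> * D" if i: "i < n" for i
    proof -
      have "(\<Sum>j<n. if i = j then 0 else z $ i * z $ j * C $$ (i, j) - 1) =
          \<sigma> * (z $ i * (\<Sum>j<n. off_diag W i j * z $ j))"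
        unfolding sum_distrib_left using i by (intro sum.cong refl A) auto
      moreover have "\<bar>z $ i\<bar> = 1" using z(2)[OF i] by auto
      ultimately show ?thesis using row[OF i] \<sigma> by (simp add: abs_mult mult_left_mono)
    qed
    show "\<bar>\<Sum>i<n. \<Sum>j<n. (if i = j then 0 else z $ i * z $ j * C $$ (i, j) - 1) * v i * v j\<bar> \<le>
        \<sigma> * N * (\<Sum>i<n. (v i)\<^sup>2)" for v
    proof -
      have "(\<Sum>i<n. \<Sum>j<n. (if i = j then 0 else z $ i * z $ j * C $$ (i, j) - 1) * v i * v j) =
          \<sigma> * quad_form n (off_diag W) (\<lambda>i. z $ i * v i)"
        unfolding quad_form_def sum_distrib_left
      proof (intro sum.cong refl)
        fix i j assume "i \<in> {..<n}" "j \<in> {..<n}"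
        then have ij: "i < n" "j < n" by auto
        show "(if i = j then 0 else z $ i * z $ j * C $$ (i, j) - 1) * v i * v j =
            \<sigma> * (off_diag W i j * (z $ i * v i) * (z $ j * v j))"
          unfolding A[OF ij] by (simp only: mult_ac)
      qed
      moreover have "(\<Sum>i<n. (z $ i * v i)\<^sup>2) = (\<Sum>i<n. (v i)\<^sup>2)"
        by (intro sum.cong refl) (simp add: power_mult_distrib power2_eq_square[of "z $ _"] sq)
      ultimately show ?thesis
        using quad[of "\<lambda>i. z $ i * v i"] \<sigma> by (simp add: abs_mult mult.assoc mult_left_mono)
    qed
    show "(real r - 1) * (\<sigma> * D) + (real r + 3) * (\<sigma> * N) \<le> (real r - 3) * real n" by (rule small)
  qed
qed

theorem corollary1:
  fixes M :: "nat \<Rightarrow> 'a measure"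
    and W :: "nat \<Rightarrow> 'a \<Rightarrow> real mat"
    and z :: "nat \<Rightarrow> real vec"
    and \<sigma> :: "nat \<Rightarrow> real"
    and \<epsilon> :: real
    and r0 :: nat
  assumes prob: "\<And>n. n \<ge> 2 \<Longrightarrow> prob_space (M n)"
    and z_dim: "\<And>n. n \<ge> 2 \<Longrightarrow> z n \<in> carrier_vec n"
    and z_sign: "\<And>n i. n \<ge> 2 \<Longrightarrow> i < n \<Longrightarrow> z n $ i \<in> {1, -1}"
    and W_dim: "\<And>n \<omega>. n \<ge> 2 \<Longrightarrow> \<omega> \<in> space (M n) \<Longrightarrow> W n \<omega> \<in> carrier_mat n n"
    and W_sym: "\<And>n \<omega>. n \<ge> 2 \<Longrightarrow> \<omega> \<in> space (M n) \<Longrightarrow> transpose_mat (W n \<omega>) = W n \<omega>"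
    and W_measurable: "\<And>n i j. n \<ge> 2 \<Longrightarrow> i < n \<Longrightarrow> j < n \<Longrightarrow>
      (\<lambda>\<omega>. W n \<omega> $$ (i, j)) \<in> borel_measurable (M n)"
    and W_normal: "\<And>n i j. n \<ge> 2 \<Longrightarrow> i < j \<Longrightarrow> j < n \<Longrightarrow>
      distributed (M n) lborel (\<lambda>\<omega>. W n \<omega> $$ (i, j)) std_normal_density"
    and W_indep: "\<And>n. n \<ge> 2 \<Longrightarrow>
      prob_space.indep_vars (M n) (\<lambda>_. borel) (\<lambda>p \<omega>. W n \<omega> $$ p) {(i, j). i < j \<and> j < n}"
    and \<epsilon>_pos: "\<epsilon> > 0"
    and r0_ge: "r0 \<ge> 3"
    and \<sigma>_nonneg: "\<And>n. n \<ge> 2 \<Longrightarrow> \<sigma> n \<ge> 0"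
    and \<sigma>_le: "\<And>n. n \<ge> 2 \<Longrightarrow>
      \<sigma> n \<le> (real r0 - 3) / (real r0 - 1) * sqrt (real n / ((2 + \<epsilon>) * ln (real n)))"
  shows "(\<lambda>n. measure (M n) {\<omega> \<in> space (M n).
      \<forall>r \<ge> r0. \<forall>Y.
        second_order_critical n r
          (objective (outer_prod (z n) (z n) + \<sigma> n \<cdot>\<^sub>m W n \<omega>)) Y \<longrightarrow>
        (\<exists>u \<in> carrier_vec r. sqrt (u \<bullet> u) = 1 \<and> Y = outer_prod (z n) u)}) \<longlonglongrightarrow> 1"
proof -
  define C where "C n \<omega> = outer_prod (z n) (z n) + \<sigma> n \<cdot>\<^sub>m W n \<omega>" for n \<omega>
  define good where "good n = {\<omega> \<in> space (M n). \<forall>r \<ge> r0. \<forall>Y.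
        second_order_critical n r (objective (C n \<omega>)) Y \<longrightarrow>
        (\<exists>u \<in> carrier_vec r. sqrt (u \<bullet> u) = 1 \<and> Y = outer_prod (z n) u)}" for n
  \<comment> \<open>slightly above \<open>\<surd>(2 n ln n)\<close>, the typical maximum of \<open>n\<close> Gaussians of variance \<open>n\<close>, so
    that the failure probability still vanishes; the rest of the \<open>\<epsilon>\<close> absorbs the operator norm\<close>
  define D where "D n = sqrt ((2 + \<epsilon> / 2) * real n * ln (real n))" for n
  define \<delta> where "\<delta> n = 2 * exp (- (\<epsilon> / 4) * ln (real n)) + 2 * exp (- real n)" for n
  have good_iff: "\<omega> \<in> good n \<longleftrightarrow> \<omega> \<in> space (M n) \<and> (\<forall>r\<ge>r0. \<forall>Y.
      second_order_critical n r (objective (C n \<omega>)) Y \<longrightarrow> aligned n r (z n) Y)" if n: "n \<ge> 2" for n \<omega>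
  proof -
    have "(\<exists>u \<in> carrier_vec r. sqrt (u \<bullet> u) = 1 \<and> Y = outer_prod (z n) u) \<longleftrightarrow> aligned n r (z n) Y"
      if "second_order_critical n r (objective (C n \<omega>)) Y" for r Y
      using that n by (intro aligned_iff_outer_prod z_dim z_sign) (auto simp: second_order_critical_def)
    then show ?thesis unfolding good_def by blast
  qed
  have good_ev: "good n \<in> sets (M n)" if n: "n \<ge> 2" for n
  proof -
    have Cc: "C n \<omega> \<in> carrier_mat n n" if "\<omega> \<in> space (M n)" for \<omega>
      unfolding C_def by (rule spiked_mat_carrier[OF z_dim[OF n] W_dim[OF n that]])
    have Cix: "C n \<omega> $$ (i, j) = z n $ i * z n $ j + \<sigma> n * W n \<omega> $$ (i, j)"
      if "\<omega> \<in> space (M n)" "i < n" "j < n" for \<omega> i j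
      unfolding C_def by (rule spiked_mat_index[OF z_dim[OF n] W_dim[OF n that(1)] that(2,3)])
    have Csym: "transpose_mat (C n \<omega>) = C n \<omega>" if "\<omega> \<in> space (M n)" for \<omega>
      unfolding C_def by (rule spiked_mat_symmetric[OF z_dim[OF n] W_dim[OF n that] W_sym[OF n that]])
    have Cmeas: "(\<lambda>\<omega>. C n \<omega> $$ (i, j)) \<in> borel_measurable (M n)" if ij: "i < n" "j < n" for i j
    proof -
      have "(\<lambda>\<omega>. z n $ i * z n $ j + \<sigma> n * W n \<omega> $$ (i, j)) \<in> borel_measurable (M n)"
        using W_measurable[OF n ij] by measurable
      then show ?thesis by (rule measurable_cong[THEN iffD1, rotated]) (simp add: Cix ij)
    qed
    have "good n = space (M n) - (\<Union>r\<in>{r0..}.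
        {\<omega> \<in> space (M n). \<exists>Y. second_order_critical n r (objective (C n \<omega>)) Y \<and> \<not> aligned n r (z n) Y})"
      using good_iff[OF n] by fastforce
    also have "\<dots> \<in> sets (M n)"
      using sets_critical_not_aligned[where C = "C n", OF Cc Csym Cmeas]
      by (intro sets.Diff sets.top sets.countable_UN') auto
    finally show ?thesis .
  qed
  have limit: "\<delta> \<longlonglongrightarrow> 0"
  proof -
    have ln: "filterlim (\<lambda>n. ln (real n)) at_top sequentially"
      by (rule filterlim_compose[OF ln_at_top filterlim_real_sequentially])
    have "filterlim (\<lambda>n. - (\<epsilon> / 4) * ln (real n)) at_bot sequentially"
      using \<epsilon>_pos by (intro filterlim_tendsto_neg_mult_at_bot[OF tendsto_const _ ln]) simp
    then have "(\<lambda>n. exp (- (\<epsilon> / 4) * ln (real n))) \<longlonglongrightarrow> 0"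
      by (rule filterlim_compose[OF exp_at_bot])
    moreover have "(\<lambda>n. exp (- real n)) \<longlonglongrightarrow> 0"
      by (intro filterlim_compose[OF exp_at_bot] filterlim_compose[OF filterlim_uminus_at_bot_at_top]
          filterlim_real_sequentially)
    ultimately have "\<delta> \<longlonglongrightarrow> 2 * 0 + 2 * 0"
      unfolding \<delta>_def[abs_def] by (intro tendsto_add tendsto_mult tendsto_const)
    then show ?thesis by simp
  qed
  have large: "\<forall>\<^sub>F n in sequentially. n \<ge> 2 \<and> D n + 3 * (40 * sqrt n) \<le> sqrt ((2 + \<epsilon>) * real n * ln (real n))"
  proof -
    define d where "d = sqrt (2 + \<epsilon>) - sqrt (2 + \<epsilon> / 2)"
    have d: "d > 0" using \<epsilon>_pos by (simp add: d_def)
    have "filterlim (\<lambda>n. sqrt (ln (real n))) at_top sequentially"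
      by (rule filterlim_compose[OF sqrt_at_top filterlim_compose[OF ln_at_top filterlim_real_sequentially]])
    then have "\<forall>\<^sub>F n in sequentially. sqrt (ln (real n)) \<ge> 120 / d" by (simp add: filterlim_at_top)
    then show ?thesis
      using eventually_ge_at_top[of 2]
    proof eventually_elim
      case (elim n)
      have "120 \<le> d * sqrt (ln n)" using elim(1) d by (simp add: field_simps)
      then have "120 * sqrt n \<le> d * sqrt (ln n) * sqrt n" by (intro mult_right_mono) auto
      then show ?case
        using elim(2) unfolding D_def d_def real_sqrt_mult by (simp add: algebra_simps)
    qed
  qed
  have lower: "\<forall>\<^sub>F n in sequentially. 1 - \<delta> n \<le> measure (M n) (good n)"
    using large
  proof eventually_elim
    case (elim n)
    then have n: "n \<ge> 2" and DN: "D n + 3 * (40 * sqrt n) \<le> sqrt ((2 + \<epsilon>) * real n * ln (real n))" by auto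
    interpret prob_space "M n" by (rule prob[OF n])
    have ln: "ln (real n) > 0" using n by simp
    have D: "D n > 0" using n ln \<epsilon>_pos by (simp add: D_def)
    have sq: "(z n $ j)\<^sup>2 = 1" if "j < n" for j using z_sign[OF n that] by auto
    obtain E where E: "E \<in> events"
      and pE: "prob E \<ge> 1 - (2 * real n * exp (- ((D n)\<^sup>2 / (2 * real n))) + 2 * exp (- real n))"
      and row: "\<And>\<omega> i. \<omega> \<in> E \<Longrightarrow> i < n \<Longrightarrow> \<bar>\<Sum>j<n. off_diag (W n \<omega>) i j * z n $ j\<bar> \<le> D n"
      and quad: "\<And>\<omega> v. \<omega> \<in> E \<Longrightarrow>
        \<bar>quad_form n (off_diag (W n \<omega>)) v\<bar> \<le> 40 * sqrt n * (\<Sum>i<n. (v i)\<^sup>2)"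
      using gaussian_matrix_bounds[of n "D n" "W n" "\<lambda>j. z n $ j", OF _ D W_dim[OF n] W_sym[OF n]
          W_normal[OF n] W_indep[OF n] sq] n by auto
    have Dsq: "(D n)\<^sup>2 / (2 * real n) = ln (real n) + \<epsilon> / 4 * ln (real n)"
      using n ln \<epsilon>_pos by (simp add: D_def field_simps)
    have "- (ln (real n) + \<epsilon> / 4 * ln (real n)) = - (\<epsilon> / 4) * ln (real n) - ln (real n)" by simp
    then have "2 * real n * exp (- ((D n)\<^sup>2 / (2 * real n))) = 2 * exp (- (\<epsilon> / 4) * ln (real n))"
      unfolding Dsq using n by (simp only: exp_diff) simp
    then have pE': "1 - \<delta> n \<le> prob E" using pE by (simp add: \<delta>_def)
    have \<sigma>: "\<sigma> n * (D n + 3 * (40 * sqrt n)) \<le> (real r0 - 3) / (real r0 - 1) * real n"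
    proof -
      have "\<sigma> n * (D n + 3 * (40 * sqrt n)) \<le>
        (real r0 - 3) / (real r0 - 1) *
        (sqrt (real n / ((2 + \<epsilon>) * ln (real n))) * sqrt ((2 + \<epsilon>) * real n * ln (real n)))"
        unfolding mult.assoc[symmetric]
        using \<sigma>_le[OF n] \<sigma>_nonneg[OF n] DN D by (intro mult_mono) auto
      also have "sqrt (real n / ((2 + \<epsilon>) * ln (real n))) * sqrt ((2 + \<epsilon>) * real n * ln (real n)) = real n"
        using ln \<epsilon>_pos by (simp add: real_sqrt_mult[symmetric])
      finally show ?thesis .
    qed
    have "E \<subseteq> good n"
    proof
      fix \<omega> assume \<omega>: "\<omega> \<in> E"
      then have \<omega>s: "\<omega> \<in> space (M n)" using E sets.sets_into_space by blast
      have "aligned n r (z n) Y" if r: "r \<ge> r0" and soc: "second_order_critical n r (objective (C n \<omega>)) Y" for r Y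
      proof (rule spiked_critical_point_aligned[OF z_dim[OF n] z_sign[OF n] W_dim[OF n \<omega>s] W_sym[OF n \<omega>s]
            \<sigma>_nonneg[OF n] soc[unfolded C_def] _ row[OF \<omega>] quad[OF \<omega>]])
        show "3 \<le> r" using r r0_ge by simp
        have "(real r - 1) * (\<sigma> n * D n) + (real r + 3) * (\<sigma> n * (40 * sqrt n)) \<le>
          (real r - 1) * (\<sigma> n * (D n + 3 * (40 * sqrt n)))"
        proof -
          \<comment> \<open>\<open>r + 3 \<le> 3 (r - 1)\<close> as \<open>r \<ge> 3\<close>\<close>
          have "(real r + 3) * (\<sigma> n * (40 * sqrt n)) \<le> (3 * (real r - 1)) * (\<sigma> n * (40 * sqrt n))"
            using r r0_ge \<sigma>_nonneg[OF n] by (intro mult_right_mono) auto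
          then show ?thesis by (simp add: algebra_simps)
        qed
        also have "\<dots> \<le> (real r - 1) * ((real r0 - 3) / (real r0 - 1) * real n)"
          using \<sigma> r r0_ge by (intro mult_left_mono) auto
        also have "\<dots> = (real r - 1) * (real r0 - 3) / (real r0 - 1) * real n" by simp
        also have "\<dots> \<le> (real r - 3) * real n"
        proof (rule mult_right_mono)
          \<comment> \<open>the threshold \<open>(r - 3) / (r - 1)\<close> increases with \<open>r\<close>, so one event serves all \<open>r \<ge> r0\<close>\<close>
          have "(real r - 1) * (real r0 - 3) \<le> (real r - 3) * (real r0 - 1)"
            using r by (simp add: algebra_simps)
          then show "(real r - 1) * (real r0 - 3) / (real r0 - 1) \<le> real r - 3"
            using r0_ge by (simp add: pos_divide_le_eq)
        qed simp
        finally show "(real r - 1) * (\<sigma> n * D n) + (real r + 3) * (\<sigma> n * (40 * sqrt n)) \<le> (real r - 3) * real n" .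
      qed
      then show "\<omega> \<in> good n" using good_iff[OF n] \<omega>s by blast
    qed
    then have "prob E \<le> prob (good n)" using good_ev[OF n] by (intro finite_measure_mono)
    then show ?case using pE' by linarith
  qed
  have upper: "\<forall>\<^sub>F n in sequentially. measure (M n) (good n) \<le> 1"
    using eventually_ge_at_top[of 2] by eventually_elim (simp add: prob prob_space.prob_le_1)
  have "(\<lambda>n. 1 - \<delta> n) \<longlonglongrightarrow> 1" using tendsto_diff[OF tendsto_const limit, of 1] by simp
  from tendsto_sandwich[OF lower upper this tendsto_const]
  show ?thesis by (simp add: good_def C_def)
qed

end
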